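(* Let $n\geq 1$ and let $(\mathcal{C},\Sigma,\mathcal{T})$ be a weak pre-$(n+2)$-angulated category (respectively, a weak $(n+2)$-angulated category). Then any skeleton $\mathcal{C}^{\mathrm{skel}}$ of $\mathcal{C}$ is a strong pre-$(n+2)$-angulated category (respectively, a strong $(n+2)$-angulated category); that is, there exist an automorphism $\Sigma'$ of $\mathcal{C}^{\mathrm{skel}}$ and a class $\mathcal{T}'$ of $(n+2)$-$\Sigma'$-sequences in $\mathcal{C}^{\mathrm{skel}}$ such that $(\mathcal{C}^{\mathrm{skel}},\Sigma',\mathcal{T}')$ is a strong pre-$(n+2)$-angulated category (respectively, a strong $(n+2)$-angulated category).
   Context: A category is skeletal if isomorphic objects are equal. A skeleton of a category $\mathcal{A}$ is a full, skeletal subcategory $\mathcal{B}$ of $\mathcal{A}$ such that the canonical inclusion $\mathcal{B}\hookrightarrow\mathcal{A}$ is essentially surjective. Fix an integer $n\geq 1$, an additive category $\mathcal{C}$ and an autoequivalence $\Sigma\colon\mathcal{C}\to\mathcal{C}$ (not necessarily an automorphism). An $(n+2)$-$\Sigma$-sequence is a sequence of morphisms $X^0\xrightarrow{d_X^0}X^1\xrightarrow{d_X^1}\cdots\xrightarrow{d_X^n}X^{n+1}\xrightarrow{d_X^{n+1}}\Sigma X^0$ in $\mathcal{C}$. A morphism of $(n+2)$-$\Sigma$-sequences from $(X^i,d_X^i)$ to $(Y^i,d_Y^i)$ is a tuple $(f^0,\dots,f^{n+1})$ of morphisms $f^i\colon X^i\to Y^i$ with $f^{i+1}d_X^i=d_Y^if^i$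 for $0\leq i\leq n$ and $(\Sigma f^0)d_X^{n+1}=d_Y^{n+1}f^{n+1}$. Let $\mathcal{T}$ be a class of $(n+2)$-$\Sigma$-sequences. The triple $(\mathcal{C},\Sigma,\mathcal{T})$ is a weak pre-$(n+2)$-angulated category if (F1)–(F3) hold, and a weak $(n+2)$-angulated category if (F1)–(F4) hold: (F1) (a) $\mathcal{T}$ is closed under finite direct sums and direct summands; (b) for each $X\in\mathcal{C}$ the sequence $X\xrightarrow{1_X}X\to 0\to\cdots\to 0\to\Sigma X$ is in $\mathcal{T}$; (c) each morphism $d_X^0$ of $\mathcal{C}$ is the first morphism of some member of $\mathcal{T}$. (F2) $X^0\xrightarrow{d_X^0}\cdots\xrightarrow{d_X^n}X^{n+1}\xrightarrow{d_X^{n+1}}\Sigma X^0$ is in $\mathcal{T}$ if and only if $X^1\xrightarrow{d_X^1}\cdots\xrightarrow{d_X^n}X^{n+1}\xrightarrow{d_X^{n+1}}\Sigma X^0\xrightarrow{(-1)^n\Sigma d_X^0}\Sigma X^1$ is in $\mathcal{T}$. (F3) Given two members $(X^i,d_X^i)$, $(Y^i,d_Y^i)$ of $\mathcal{T}$ and morphisms $f^0\colon X^0\to Y^0$, $f^1\colon X^1\to Y^1$ with $f^1d_X^0=d_Y^0f^0$, there are $f^2,\dots,f^{n+1}$ such that $(f^0,\dots,f^{n+1})$ is a morphism of $(n+2)$-$\Sigma$-sequences. (F4) In (F3), $f^2,\dots,f^{n+1}$ can be chosen so that the cone $X^1\oplus Y^0\xrightarrow{d_C^0}X^2\oplus Y^1\xrightarrow{d_C^1}\cdots\xrightarrow{d_C^n}\Sigma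 X^0\oplus Y^{n+1}\xrightarrow{d_C^{n+1}}\Sigma X^1\oplus\Sigma Y^0$ lies in $\mathcal{T}$, where $d_C^i=\begin{pmatrix}-d_X^{i+1}&0\\ f^{i+1}&d_Y^i\end{pmatrix}$, $d_X^{n+2}:=\Sigma d_X^0$, $f^{n+2}:=\Sigma f^0$. A weak (pre-)$(n+2)$-angulated category is called a strong (pre-)$(n+2)$-angulated category if $\Sigma$ is an automorphism (i.e. an isomorphism of categories $\mathcal{C}\to\mathcal{C}$). *)

theory Defs
  imports "HOL-Algebra.Group"
begin

section \<open>Categories\<close>

text \<open>Objects and arrows are carved out of ambient types by the sets \<open>ob\<close> and \<open>arr\<close>; the
  operations are meaningful only on these sets (and on composable, resp. parallel, arrows).\<close>

record ('o, 'm) cat_data =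
  ob :: "'o set"
  arr :: "'m set"
  src :: "'m \<Rightarrow> 'o"
  tgt :: "'m \<Rightarrow> 'o"
  ide :: "'o \<Rightarrow> 'm"
  cmp :: "'m \<Rightarrow> 'm \<Rightarrow> 'm"  (infixl "\<cdot>\<index>" 70)

definition Hom :: "('o, 'm, 'z) cat_data_scheme \<Rightarrow> 'o \<Rightarrow> 'o \<Rightarrow> 'm set" where
  "Hom C X Y = {f \<in> arr C. src C f = X \<and> tgt C f = Y}"

locale category =
  fixes C :: "('o, 'm, 'z) cat_data_scheme" (structure)
  assumes src_in_ob: "f \<in> arr C \<Longrightarrow> src C f \<in> ob C"
    and tgt_in_ob: "f \<in> arr C \<Longrightarrow> tgt C f \<in> ob C"
    and ide_in_Hom: "X \<in> ob C \<Longrightarrow> ide C X \<in> Hom C X X"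
    and cmp_in_Hom: "\<lbrakk>f \<in> Hom C X Y; g \<in> Hom C Y Z\<rbrakk> \<Longrightarrow> g \<cdot> f \<in> Hom C X Z"
    and cmp_ide_right: "f \<in> Hom C X Y \<Longrightarrow> f \<cdot> ide C X = f"
    and cmp_ide_left: "f \<in> Hom C X Y \<Longrightarrow> ide C Y \<cdot> f = f"
    and cmp_assoc: "\<lbrakk>f \<in> Hom C W X; g \<in> Hom C X Y; h \<in> Hom C Y Z\<rbrakk> \<Longrightarrow>
      (h \<cdot> g) \<cdot> f = h \<cdot> (g \<cdot> f)"

definition is_iso :: "('o, 'm, 'z) cat_data_scheme \<Rightarrow> 'o \<Rightarrow> 'o \<Rightarrow> 'm \<Rightarrow> bool" where
  "is_iso C X Y f \<longleftrightarrow> f \<in> Hom C X Y \<and>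
    (\<exists>g \<in> Hom C Y X. g \<cdot>\<^bsub>C\<^esub> f = ide C X \<and> f \<cdot>\<^bsub>C\<^esub> g = ide C Y)"

definition isomorphic :: "('o, 'm, 'z) cat_data_scheme \<Rightarrow> 'o \<Rightarrow> 'o \<Rightarrow> bool" where
  "isomorphic C X Y \<longleftrightarrow> (\<exists>f. is_iso C X Y f)"

definition zero_object :: "('o, 'm, 'z) cat_data_scheme \<Rightarrow> 'o \<Rightarrow> bool" where
  "zero_object C X \<longleftrightarrow> X \<in> ob C \<and>
    (\<forall>Y \<in> ob C. (\<exists>!f. f \<in> Hom C X Y) \<and> (\<exists>!f. f \<in> Hom C Y X))"


section \<open>Functors and equivalences\<close>

record ('o, 'm, 'p, 'k) cat_functor =
  fob :: "'o \<Rightarrow> 'p"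
  farr :: "'m \<Rightarrow> 'k"

definition is_functor ::
  "('o, 'm, 'z) cat_data_scheme \<Rightarrow> ('p, 'k, 'y) cat_data_scheme \<Rightarrow> ('o, 'm, 'p, 'k) cat_functor \<Rightarrow> bool"
  where
  "is_functor A B F \<longleftrightarrow>
    (\<forall>X \<in> ob A. fob F X \<in> ob B) \<and>
    (\<forall>X \<in> ob A. \<forall>Y \<in> ob A. \<forall>f \<in> Hom A X Y. farr F f \<in> Hom B (fob F X) (fob F Y)) \<and>
    (\<forall>X \<in> ob A. farr F (ide A X) = ide B (fob F X)) \<and>
    (\<forall>f \<in> arr A. \<forall>g \<in> arr A. tgt A f = src A g \<longrightarrow>
      farr F (g \<cdot>\<^bsub>A\<^esub> f) = farr F g \<cdot>\<^bsub>B\<^esub> farr F f)"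

definition id_functor :: "('o, 'm, 'o, 'm) cat_functor" where
  "id_functor = \<lparr>fob = (\<lambda>X. X), farr = (\<lambda>f. f)\<rparr>"

definition comp_functor ::
  "('p, 'k, 'q, 'l) cat_functor \<Rightarrow> ('o, 'm, 'p, 'k) cat_functor \<Rightarrow> ('o, 'm, 'q, 'l) cat_functor"
  where
  "comp_functor G F = \<lparr>fob = (\<lambda>X. fob G (fob F X)), farr = (\<lambda>f. farr G (farr F f))\<rparr>"

definition equal_functors ::
  "('o, 'm, 'z) cat_data_scheme \<Rightarrow> ('o, 'm, 'p, 'k) cat_functor \<Rightarrow> ('o, 'm, 'p, 'k) cat_functor \<Rightarrow> bool"
  where
  "equal_functors A F G \<longleftrightarrow>
    (\<forall>X \<in> ob A. fob F X = fob G X) \<and> (\<forall>f \<in> arr A. farr F f = farr G f)"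

definition naturally_isomorphic ::
  "('o, 'm, 'z) cat_data_scheme \<Rightarrow> ('p, 'k, 'y) cat_data_scheme \<Rightarrow>
    ('o, 'm, 'p, 'k) cat_functor \<Rightarrow> ('o, 'm, 'p, 'k) cat_functor \<Rightarrow> bool"
  where
  "naturally_isomorphic A B F G \<longleftrightarrow> (\<exists>\<eta>.
    (\<forall>X \<in> ob A. is_iso B (fob F X) (fob G X) (\<eta> X)) \<and>
    (\<forall>f \<in> arr A. \<eta> (tgt A f) \<cdot>\<^bsub>B\<^esub> farr F f = farr G f \<cdot>\<^bsub>B\<^esub> \<eta> (src A f)))"

definition autoequivalence ::
  "('o, 'm, 'z) cat_data_scheme \<Rightarrow> ('o, 'm, 'o, 'm) cat_functor \<Rightarrow> bool" where
  "autoequivalence C F \<longleftrightarrow> is_functor C C F \<and> (\<exists>G. is_functor C C G \<and>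
    naturally_isomorphic C C (comp_functor G F) id_functor \<and>
    naturally_isomorphic C C (comp_functor F G) id_functor)"

definition automorphism ::
  "('o, 'm, 'z) cat_data_scheme \<Rightarrow> ('o, 'm, 'o, 'm) cat_functor \<Rightarrow> bool" where
  "automorphism C F \<longleftrightarrow> is_functor C C F \<and> (\<exists>G. is_functor C C G \<and>
    equal_functors C (comp_functor G F) id_functor \<and>
    equal_functors C (comp_functor F G) id_functor)"

definition essentially_surjective ::
  "('o, 'm, 'z) cat_data_scheme \<Rightarrow> ('p, 'k, 'y) cat_data_scheme \<Rightarrow> ('o, 'm, 'p, 'k) cat_functor \<Rightarrow> bool"
  where
  "essentially_surjective A B F \<longleftrightarrow> (\<forall>Y \<in> ob B. \<exists>X \<in> ob A. isomorphic B (fob F X) Y)"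


section \<open>Skeletons\<close>

text \<open>Any additional structure on the category, such as an addition on the arrows, is inherited.\<close>

definition full_subcategory ::
  "('o, 'm, 'z) cat_data_scheme \<Rightarrow> 'o set \<Rightarrow> ('o, 'm, 'z) cat_data_scheme" where
  "full_subcategory A S = A\<lparr>ob := S, arr := {f \<in> arr A. src A f \<in> S \<and> tgt A f \<in> S}\<rparr>"

definition skeletal :: "('o, 'm, 'z) cat_data_scheme \<Rightarrow> bool" where
  "skeletal C \<longleftrightarrow> (\<forall>X \<in> ob C. \<forall>Y \<in> ob C. isomorphic C X Y \<longrightarrow> X = Y)"

definition is_skeleton ::
  "('o, 'm, 'z) cat_data_scheme \<Rightarrow> ('o, 'm, 'z) cat_data_scheme \<Rightarrow> bool" where
  "is_skeleton B A \<longleftrightarrow> (\<exists>S. S \<subseteq> ob A \<and> B = full_subcategory A S) \<and>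
    skeletal B \<and> essentially_surjective B A id_functor"


section \<open>Additive categories\<close>

record ('o, 'm) add_cat_data = "('o, 'm) cat_data" +
  hplus :: "'m \<Rightarrow> 'm \<Rightarrow> 'm"  (infixl "\<boxplus>\<index>" 65)
  hzero :: "'o \<Rightarrow> 'o \<Rightarrow> 'm"

definition hom_group :: "('o, 'm, 'z) add_cat_data_scheme \<Rightarrow> 'o \<Rightarrow> 'o \<Rightarrow> 'm monoid" where
  "hom_group C X Y = \<lparr>carrier = Hom C X Y, monoid.mult = hplus C, one = hzero C X Y\<rparr>"

definition hneg :: "('o, 'm, 'z) add_cat_data_scheme \<Rightarrow> 'm \<Rightarrow> 'm" where
  "hneg C f = inv\<^bsub>hom_group C (src C f) (tgt C f)\<^esub> f"

locale preadditive_category = category C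
  for C :: "('o, 'm, 'z) add_cat_data_scheme" (structure) +
  assumes hom_comm_group: "\<lbrakk>X \<in> ob C; Y \<in> ob C\<rbrakk> \<Longrightarrow> comm_group (hom_group C X Y)"
    and cmp_hplus_right: "\<lbrakk>f \<in> Hom C X Y; f' \<in> Hom C X Y; g \<in> Hom C Y Z\<rbrakk> \<Longrightarrow>
      g \<cdot> (f \<boxplus> f') = g \<cdot> f \<boxplus> g \<cdot> f'"
    and cmp_hplus_left: "\<lbrakk>f \<in> Hom C X Y; g \<in> Hom C Y Z; g' \<in> Hom C Y Z\<rbrakk> \<Longrightarrow>
      (g \<boxplus> g') \<cdot> f = g \<cdot> f \<boxplus> g' \<cdot> f"

definition is_biproduct ::
  "('o, 'm, 'z) add_cat_data_scheme \<Rightarrow> 'o \<Rightarrow> 'o \<Rightarrow> 'o \<Rightarrow> 'm \<Rightarrow> 'm \<Rightarrow> 'm \<Rightarrow> 'm \<Rightarrow> bool" where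
  "is_biproduct C X Y Z i j p q \<longleftrightarrow>
    i \<in> Hom C X Z \<and> j \<in> Hom C Y Z \<and> p \<in> Hom C Z X \<and> q \<in> Hom C Z Y \<and>
    p \<cdot>\<^bsub>C\<^esub> i = ide C X \<and> q \<cdot>\<^bsub>C\<^esub> j = ide C Y \<and>
    p \<cdot>\<^bsub>C\<^esub> j = hzero C Y X \<and> q \<cdot>\<^bsub>C\<^esub> i = hzero C X Y \<and>
    i \<cdot>\<^bsub>C\<^esub> p \<boxplus>\<^bsub>C\<^esub> j \<cdot>\<^bsub>C\<^esub> q = ide C Z"

locale additive_category = preadditive_category C
  for C :: "('o, 'm, 'z) add_cat_data_scheme" (structure) +
  assumes has_zero_object: "\<exists>Z. zero_object C Z"
    and has_biproducts: "\<lbrakk>X \<in> ob C; Y \<in> ob C\<rbrakk> \<Longrightarrow>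
      \<exists>Z \<in> ob C. \<exists>i j p q. is_biproduct C X Y Z i j p q"


section \<open>Sequences\<close>

text \<open>An \<open>(n+2)\<close>-\<open>\<Sigma>\<close>-sequence is the list \<open>[d\<^sup>0, \<dots>, d\<^sup>n\<^sup>+\<^sup>1]\<close> of its arrows. The objects are
  recovered from it: the \<open>i\<close>-th one is the source of the \<open>i\<close>-th arrow.\<close>

definition sigma_sequence ::
  "nat \<Rightarrow> ('o, 'm, 'z) cat_data_scheme \<Rightarrow> ('o, 'm, 'o, 'm) cat_functor \<Rightarrow> 'm list \<Rightarrow> bool" where
  "sigma_sequence n C \<Sigma> x \<longleftrightarrow> length x = n + 2 \<and> set x \<subseteq> arr C \<and>
    (\<forall>i \<le> n. tgt C (x ! i) = src C (x ! (i + 1))) \<and>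
    tgt C (x ! (n + 1)) = fob \<Sigma> (src C (x ! 0))"

text \<open>Only the values of \<open>f\<close> at \<open>0, \<dots>, n + 1\<close> matter.\<close>

definition seq_morphism ::
  "nat \<Rightarrow> ('o, 'm, 'z) cat_data_scheme \<Rightarrow> ('o, 'm, 'o, 'm) cat_functor \<Rightarrow>
    'm list \<Rightarrow> 'm list \<Rightarrow> (nat \<Rightarrow> 'm) \<Rightarrow> bool" where
  "seq_morphism n C \<Sigma> x y f \<longleftrightarrow>
    (\<forall>i \<le> n + 1. f i \<in> Hom C (src C (x ! i)) (src C (y ! i))) \<and>
    (\<forall>i \<le> n. f (i + 1) \<cdot>\<^bsub>C\<^esub> x ! i = y ! i \<cdot>\<^bsub>C\<^esub> f i) \<and>
    farr \<Sigma> (f 0) \<cdot>\<^bsub>C\<^esub> x ! (n + 1) = y ! (n + 1) \<cdot>\<^bsub>C\<^esub> f (n + 1)"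

text \<open>\<open>z\<close> is a biproduct of \<open>x\<close> and \<open>y\<close> in the category of \<open>(n+2)\<close>-\<open>\<Sigma>\<close>-sequences.\<close>

definition seq_direct_sum ::
  "nat \<Rightarrow> ('o, 'm, 'z) add_cat_data_scheme \<Rightarrow> ('o, 'm, 'o, 'm) cat_functor \<Rightarrow>
    'm list \<Rightarrow> 'm list \<Rightarrow> 'm list \<Rightarrow> bool" where
  "seq_direct_sum n C \<Sigma> x y z \<longleftrightarrow> (\<exists>i j p q.
    seq_morphism n C \<Sigma> x z i \<and> seq_morphism n C \<Sigma> y z j \<and>
    seq_morphism n C \<Sigma> z x p \<and> seq_morphism n C \<Sigma> z y q \<and>
    (\<forall>k \<le> n + 1. is_biproduct C (src C (x ! k)) (src C (y ! k)) (src C (z ! k))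
      (i k) (j k) (p k) (q k)))"

definition rotation ::
  "nat \<Rightarrow> ('o, 'm, 'z) add_cat_data_scheme \<Rightarrow> ('o, 'm, 'o, 'm) cat_functor \<Rightarrow> 'm list \<Rightarrow> 'm list" where
  "rotation n C \<Sigma> x =
    tl x @ [if even n then farr \<Sigma> (x ! 0) else hneg C (farr \<Sigma> (x ! 0))]"

text \<open>\<open>c\<close> is a cone of the morphism \<open>f\<close> from \<open>x\<close> to \<open>y\<close>, formed with respect to some choice of
  biproducts for \<open>X\<^sup>k\<^sup>+\<^sup>1 \<oplus> Y\<^sup>k\<close> (\<open>0 \<le> k \<le> n + 1\<close>); here \<open>dx ! (n + 2) = \<Sigma> d\<^sub>X\<^sup>0\<close>
  and \<open>f' (n + 2) = \<Sigma> f\<^sup>0\<close>. The last arrow has to end in \<open>\<Sigma> (X\<^sup>1 \<oplus> Y\<^sup>0)\<close>, which is regarded as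
  \<open>\<Sigma> X\<^sup>1 \<oplus> \<Sigma> Y\<^sup>0\<close> by means of the images under \<open>\<Sigma>\<close> of the injections into \<open>X\<^sup>1 \<oplus> Y\<^sup>0\<close>. The matrix
  of the \<open>k\<close>-th differential is spelled out through injections \<open>i\<close>, \<open>j\<close> and projections \<open>p\<close>, \<open>q\<close>.\<close>

definition is_cone ::
  "nat \<Rightarrow> ('o, 'm, 'z) add_cat_data_scheme \<Rightarrow> ('o, 'm, 'o, 'm) cat_functor \<Rightarrow>
    'm list \<Rightarrow> 'm list \<Rightarrow> (nat \<Rightarrow> 'm) \<Rightarrow> 'm list \<Rightarrow> bool" where
  "is_cone n C \<Sigma> x y f c \<longleftrightarrow> sigma_sequence n C \<Sigma> c \<and>
    (let dx = x @ [farr \<Sigma> (x ! 0)]; f' = f(n + 2 := farr \<Sigma> (f 0)) in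
      \<exists>i j p q.
        (\<forall>k \<le> n + 1. is_biproduct C (src C (dx ! (k + 1))) (src C (y ! k)) (src C (c ! k))
          (i k) (j k) (p k) (q k)) \<and>
        i (n + 2) = farr \<Sigma> (i 0) \<and> j (n + 2) = farr \<Sigma> (j 0) \<and>
        (\<forall>k \<le> n + 1. c ! k =
          i (k + 1) \<cdot>\<^bsub>C\<^esub> hneg C (dx ! (k + 1)) \<cdot>\<^bsub>C\<^esub> p k \<boxplus>\<^bsub>C\<^esub>
          j (k + 1) \<cdot>\<^bsub>C\<^esub> f' (k + 1) \<cdot>\<^bsub>C\<^esub> p k \<boxplus>\<^bsub>C\<^esub>
          j (k + 1) \<cdot>\<^bsub>C\<^esub> y ! k \<cdot>\<^bsub>C\<^esub> q k))"


section \<open>Weak and strong \<open>(n+2)\<close>-angulated categories\<close>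

text \<open>No additivity of \<open>\<Sigma>\<close> is imposed: it is automatic for an equivalence of additive categories.
  Direct sums are not chosen, so closure under them refers to all possible choices and includes closure
  under isomorphism; finite direct sums are binary ones and the empty one (\<open>F1a_zero\<close>). By
  commutativity of the direct sum, \<open>F1a_summand\<close> covers both summands.\<close>

locale weak_pre_angulated_category = additive_category C
  for n :: nat
    and C :: "('o, 'm, 'z) add_cat_data_scheme" (structure)
    and \<Sigma> :: "('o, 'm, 'o, 'm) cat_functor"
    and \<T> :: "'m list set" +
  assumes n_ge_1: "n \<ge> 1"
    and autoequivalence: "autoequivalence C \<Sigma>"
    and sequences: "x \<in> \<T> \<Longrightarrow> sigma_sequence n C \<Sigma> x"
    and F1a_zero: "\<lbrakk>sigma_sequence n C \<Sigma> z; \<forall>k \<le> n + 1. zero_object C (src C (z ! k))\<rbrakk> \<Longrightarrow> z \<in> \<T>"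
    and F1a_sum: "\<lbrakk>x \<in> \<T>; y \<in> \<T>; sigma_sequence n C \<Sigma> z; seq_direct_sum n C \<Sigma> x y z\<rbrakk> \<Longrightarrow> z \<in> \<T>"
    and F1a_summand: "\<lbrakk>z \<in> \<T>; sigma_sequence n C \<Sigma> x; sigma_sequence n C \<Sigma> y;
      seq_direct_sum n C \<Sigma> x y z\<rbrakk> \<Longrightarrow> x \<in> \<T>"
    and F1b: "\<lbrakk>X \<in> ob C; sigma_sequence n C \<Sigma> x; x ! 0 = ide C X;
      \<forall>k \<in> {2..n + 1}. zero_object C (src C (x ! k))\<rbrakk> \<Longrightarrow> x \<in> \<T>"
    and F1c: "f \<in> arr C \<Longrightarrow> \<exists>x \<in> \<T>. x ! 0 = f"
    and F2: "sigma_sequence n C \<Sigma> x \<Longrightarrow> x \<in> \<T> \<longleftrightarrow> rotation n C \<Sigma> x \<in> \<T>"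
    and F3: "\<lbrakk>x \<in> \<T>; y \<in> \<T>;
      f0 \<in> Hom C (src C (x ! 0)) (src C (y ! 0)); f1 \<in> Hom C (src C (x ! 1)) (src C (y ! 1));
      f1 \<cdot> x ! 0 = y ! 0 \<cdot> f0\<rbrakk> \<Longrightarrow>
      \<exists>f. f 0 = f0 \<and> f 1 = f1 \<and> seq_morphism n C \<Sigma> x y f"

locale weak_angulated_category = weak_pre_angulated_category n C \<Sigma> \<T>
  for n :: nat
    and C :: "('o, 'm, 'z) add_cat_data_scheme" (structure)
    and \<Sigma> :: "('o, 'm, 'o, 'm) cat_functor"
    and \<T> :: "'m list set" +
  assumes F4: "\<lbrakk>x \<in> \<T>; y \<in> \<T>;
      f0 \<in> Hom C (src C (x ! 0)) (src C (y ! 0)); f1 \<in> Hom C (src C (x ! 1)) (src C (y ! 1));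
      f1 \<cdot> x ! 0 = y ! 0 \<cdot> f0\<rbrakk> \<Longrightarrow>
      \<exists>f. f 0 = f0 \<and> f 1 = f1 \<and> seq_morphism n C \<Sigma> x y f \<and>
        (\<forall>c. is_cone n C \<Sigma> x y f c \<longrightarrow> c \<in> \<T>)"

locale strong_pre_angulated_category = weak_pre_angulated_category n C \<Sigma> \<T>
  for n :: nat
    and C :: "('o, 'm, 'z) add_cat_data_scheme" (structure)
    and \<Sigma> :: "('o, 'm, 'o, 'm) cat_functor"
    and \<T> :: "'m list set" +
  assumes automorphism: "automorphism C \<Sigma>"

locale strong_angulated_category = weak_angulated_category n C \<Sigma> \<T>
  for n :: nat
    and C :: "('o, 'm, 'z) add_cat_data_scheme" (structure)
    and \<Sigma> :: "('o, 'm, 'o, 'm) cat_functor"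
    and \<T> :: "'m list set" +
  assumes automorphism: "automorphism C \<Sigma>"

end

theory Submission
  imports Defs
begin

text \<open>Let \<open>S\<close> be the set of objects of the skeleton. Choosing an isomorphism from \<open>\<Sigma> X\<close> to an object of
  \<open>S\<close> for each \<open>X\<close> in \<open>S\<close> and conjugating by these isomorphisms transports \<open>\<Sigma>\<close> to an autoequivalence
  \<open>\<Sigma>\<^sub>S\<close> of the skeleton, and an autoequivalence of a skeletal category is bijective on objects and
  arrows. A \<open>\<Sigma>\<^sub>S\<close>-sequence is distinguished if it lies in \<open>\<T>\<close> after its last arrow is composed with
  the chosen isomorphism. The axioms carry over because \<open>\<T>\<close> is closed under isomorphism and, up to
  isomorphism, rotations and cones in the skeleton are rotations and cones in the category.\<close>

section \<open>Categories and equivalences\<close>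

text \<open>Only the last arrow of a sequence sees the functor, so \<open>\<Phi>\<close> alters this
  one arrow and no object. The chosen isomorphisms are natural between
  \<open>\<Sigma>\<^sub>S\<close> and \<Sigma>; hence the same tuples are morphisms before and after
  \<open>\<Phi>\<close>, and (F1a), (F1b) and (F3) transfer without change. The work lies where an
  axiom produces new objects or new occurrences of the functor. In (F1c) the sequence supplied by
  the category may leave the skeleton and has to be moved back without disturbing its first arrow.
  In (F2) the object \<Sigma> X^0 enters the sequence, so rotating and applying
  \<open>\<Phi>\<close> commute only up to an isomorphism concentrated in the last place. In (F4)
  the same object enters as a summand, but there \<open>\<Phi>\<close> maps cones to cones on the
  nose, since \<open>is_cone\<close> admits every choice of biproducts and the isomorphism can be
  absorbed into an injection and a projection.\<close>

context category
begin

lemma arr_ide [simp]: "X \<in> ob C \<Longrightarrow> ide C X \<in> arr C"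
  and src_ide [simp]: "X \<in> ob C \<Longrightarrow> src C (ide C X) = X"
  and tgt_ide [simp]: "X \<in> ob C \<Longrightarrow> tgt C (ide C X) = X"
  using ide_in_Hom[of X] by (auto simp: Hom_def)

lemma arr_cmp [simp]: "\<lbrakk>f \<in> arr C; g \<in> arr C; tgt C f = src C g\<rbrakk> \<Longrightarrow> g \<cdot> f \<in> arr C"
  and src_cmp [simp]: "\<lbrakk>f \<in> arr C; g \<in> arr C; tgt C f = src C g\<rbrakk> \<Longrightarrow> src C (g \<cdot> f) = src C f"
  and tgt_cmp [simp]: "\<lbrakk>f \<in> arr C; g \<in> arr C; tgt C f = src C g\<rbrakk> \<Longrightarrow> tgt C (g \<cdot> f) = tgt C g"
proof -
  assume "f \<in> arr C" "g \<in> arr C" "tgt C f = src C g"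
  then have "g \<cdot> f \<in> Hom C (src C f) (tgt C g)"
    by (intro cmp_in_Hom[where Y = "src C g"]) (auto simp: Hom_def)
  then show "g \<cdot> f \<in> arr C" "src C (g \<cdot> f) = src C f" "tgt C (g \<cdot> f) = tgt C g"
    by (auto simp: Hom_def)
qed

lemma cmp_ide [simp]:
  "\<lbrakk>f \<in> arr C; tgt C f = Y\<rbrakk> \<Longrightarrow> ide C Y \<cdot> f = f"
  "\<lbrakk>f \<in> arr C; src C f = X\<rbrakk> \<Longrightarrow> f \<cdot> ide C X = f"
  by (rule cmp_ide_left cmp_ide_right; force simp: Hom_def)+

lemma assoc:
  "\<lbrakk>f \<in> arr C; g \<in> arr C; h \<in> arr C; tgt C f = src C g; tgt C g = src C h\<rbrakk> \<Longrightarrow>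
    (h \<cdot> g) \<cdot> f = h \<cdot> (g \<cdot> f)"
  by (rule cmp_assoc[where X = "src C g" and Y = "src C h"]) (auto simp: Hom_def)

lemmas [simp] = src_in_ob tgt_in_ob

text \<open>Whereas \<open>is_iso\<close> hides the inverse behind an existential, this keeps it at
  hand for cancellation in long composites.\<close>

definition inverses :: "'m \<Rightarrow> 'm \<Rightarrow> bool" where
  "inverses f g \<longleftrightarrow> f \<in> arr C \<and> g \<in> arr C \<and> src C g = tgt C f \<and> tgt C g = src C f \<and>
    g \<cdot> f = ide C (src C f) \<and> f \<cdot> g = ide C (tgt C f)"

lemma is_iso_iff_inverses:
  "is_iso C X Y f \<longleftrightarrow> src C f = X \<and> tgt C f = Y \<and> (\<exists>g. inverses f g)"
  by (auto simp: is_iso_def inverses_def Hom_def Bex_def)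

lemma inverses_sym: "inverses f g \<Longrightarrow> inverses g f"
  by (auto simp: inverses_def)

lemma cmp_inverses:
  assumes "inverses f g" "h \<in> arr C" "tgt C h = src C f"
  shows "g \<cdot> (f \<cdot> h) = h"
  using assms assoc[of h f g] by (auto simp: inverses_def)

lemma cmp_inverses_right:
  assumes "inverses f g" "h \<in> arr C" "src C h = src C f"
  shows "(h \<cdot> g) \<cdot> f = h"
  using assms assoc[of f g h] by (auto simp: inverses_def)

lemma inverses_cmp:
  assumes "inverses f g" "inverses h k" "tgt C f = src C h"
  shows "inverses (h \<cdot> f) (g \<cdot> k)"
  using assms cmp_inverses[of h k f] cmp_inverses[of g f k]
  by (auto simp: inverses_def assoc)

lemma inverses_ide: "X \<in> ob C \<Longrightarrow> inverses (ide C X) (ide C X)"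
  by (simp add: inverses_def)

lemma isomorphic_iff: "isomorphic C X Y \<longleftrightarrow> (\<exists>f g. inverses f g \<and> src C f = X \<and> tgt C f = Y)"
  unfolding isomorphic_def is_iso_iff_inverses by blast

lemma isomorphicI: "\<lbrakk>inverses f g; src C f = X; tgt C f = Y\<rbrakk> \<Longrightarrow> isomorphic C X Y"
  by (auto simp: isomorphic_iff)

lemma isomorphicE:
  assumes "isomorphic C X Y"
  obtains f g where "inverses f g" "src C f = X" "tgt C f = Y" "src C g = Y" "tgt C g = X"
    "f \<in> arr C" "g \<in> arr C"
  using assms by (auto simp: isomorphic_iff inverses_def)

lemma isomorphic_sym: "isomorphic C X Y \<Longrightarrow> isomorphic C Y X"
  by (erule isomorphicE) (rule isomorphicI[OF inverses_sym])

lemma isomorphic_trans: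
  assumes "isomorphic C X Y" "isomorphic C Y Z"
  shows "isomorphic C X Z"
proof -
  obtain f g where f: "inverses f g" "src C f = X" "tgt C f = Y" "f \<in> arr C"
    using isomorphicE[OF assms(1)] by metis
  obtain h k where h: "inverses h k" "src C h = Y" "tgt C h = Z" "h \<in> arr C"
    using isomorphicE[OF assms(2)] by metis
  show ?thesis
    by (rule isomorphicI[OF inverses_cmp[OF f(1) h(1)]]) (use f h in auto)
qed

lemma zero_object_initial:
  assumes "zero_object C Z" "f \<in> arr C" "g \<in> arr C" "src C f = Z" "src C g = Z" "tgt C f = tgt C g"
  shows "f = g"
proof -
  have "\<exists>!h. h \<in> Hom C Z (tgt C g)" using assms unfolding zero_object_def by simp
  moreover have "f \<in> Hom C Z (tgt C g)" "g \<in> Hom C Z (tgt C g)" using assms by (auto simp: Hom_def)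
  ultimately show ?thesis by blast
qed

lemma zero_object_terminal:
  assumes "zero_object C Z" "f \<in> arr C" "g \<in> arr C" "tgt C f = Z" "tgt C g = Z" "src C f = src C g"
  shows "f = g"
proof -
  have "\<exists>!h. h \<in> Hom C (src C g) Z" using assms unfolding zero_object_def by simp
  moreover have "f \<in> Hom C (src C g) Z" "g \<in> Hom C (src C g) Z" using assms by (auto simp: Hom_def)
  ultimately show ?thesis by blast
qed

lemma zero_object_arr_from:
  assumes "zero_object C Z" "Y \<in> ob C"
  obtains h where "h \<in> arr C" "src C h = Z" "tgt C h = Y"
proof -
  have "\<exists>!h. h \<in> Hom C Z Y" using assms unfolding zero_object_def by simp
  then obtain h where "h \<in> Hom C Z Y" by (rule ex1E)
  then show thesis using that[of h] by (simp add: Hom_def)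
qed

lemma zero_object_arr_to:
  assumes "zero_object C Z" "Y \<in> ob C"
  obtains h where "h \<in> arr C" "src C h = Y" "tgt C h = Z"
proof -
  have "\<exists>!h. h \<in> Hom C Y Z" using assms unfolding zero_object_def by simp
  then obtain h where "h \<in> Hom C Y Z" by (rule ex1E)
  then show thesis using that[of h] by (simp add: Hom_def)
qed

lemma zero_object_iso:
  assumes Z: "zero_object C Z" and iso: "isomorphic C Z W"
  shows "zero_object C W"
proof -
  obtain f g where fg: "inverses f g" "inverses g f" "f \<in> arr C" "g \<in> arr C"
    "src C f = Z" "tgt C f = W" "src C g = W" "tgt C g = Z"
    using iso inverses_sym by (metis isomorphicE)
  have "W \<in> ob C" using tgt_in_ob[OF fg(3)] fg(6) by simp
  moreover have "(\<exists>!h. h \<in> Hom C W Y) \<and> (\<exists>!h. h \<in> Hom C Y W)" if Y: "Y \<in> ob C" for Y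
  proof
    obtain h where h: "h \<in> arr C" "src C h = Z" "tgt C h = Y" by (rule zero_object_arr_from[OF Z Y])
    show "\<exists>!h. h \<in> Hom C W Y"
    proof (rule ex1I[of _ "h \<cdot> g"])
      show "h \<cdot> g \<in> Hom C W Y" using h fg(3-) by (simp add: Hom_def)
      fix k assume "k \<in> Hom C W Y"
      then have k: "k \<in> arr C" "src C k = W" "tgt C k = Y" by (simp_all add: Hom_def)
      have "k \<cdot> f = h" by (rule zero_object_initial[OF Z]) (use k h fg(3-) in simp_all)
      then show "k = h \<cdot> g" using cmp_inverses_right[OF fg(2), of k] k fg(3-) by simp
    qed
    obtain h' where h': "h' \<in> arr C" "src C h' = Y" "tgt C h' = Z" by (rule zero_object_arr_to[OF Z Y])
    show "\<exists>!h. h \<in> Hom C Y W"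
    proof (rule ex1I[of _ "f \<cdot> h'"])
      show "f \<cdot> h' \<in> Hom C Y W" using h' fg(3-) by (simp add: Hom_def)
      fix k assume "k \<in> Hom C Y W"
      then have k: "k \<in> arr C" "src C k = Y" "tgt C k = W" by (simp_all add: Hom_def)
      have "g \<cdot> k = h'" by (rule zero_object_terminal[OF Z]) (use k h' fg(3-) in simp_all)
      then show "k = f \<cdot> h'" using cmp_inverses[OF fg(2), of k] k fg(3-) by simp
    qed
  qed
  ultimately show ?thesis unfolding zero_object_def by simp
qed

end

section \<open>Endofunctors and what a quasi-inverse yields\<close>

locale endofunctor = category C
  for C :: "('o, 'm, 'z) cat_data_scheme" (structure) +
  fixes F :: "('o, 'm, 'o, 'm) cat_functor"
  assumes is_functor: "is_functor C C F"
begin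

lemma fob_in_ob [simp]: "X \<in> ob C \<Longrightarrow> fob F X \<in> ob C"
  using is_functor by (simp add: is_functor_def)

lemma arr_farr [simp]: "f \<in> arr C \<Longrightarrow> farr F f \<in> arr C"
  and src_farr [simp]: "f \<in> arr C \<Longrightarrow> src C (farr F f) = fob F (src C f)"
  and tgt_farr [simp]: "f \<in> arr C \<Longrightarrow> tgt C (farr F f) = fob F (tgt C f)"
proof -
  assume f: "f \<in> arr C"
  have F: "\<forall>X \<in> ob C. \<forall>Y \<in> ob C. \<forall>f \<in> Hom C X Y. farr F f \<in> Hom C (fob F X) (fob F Y)"
    using is_functor unfolding is_functor_def by (elim conjE)
  have "farr F f \<in> Hom C (fob F (src C f)) (fob F (tgt C f))"
    by (rule F[rule_format, OF src_in_ob[OF f] tgt_in_ob[OF f]]) (simp add: Hom_def f)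
  then show "farr F f \<in> arr C" "src C (farr F f) = fob F (src C f)"
    "tgt C (farr F f) = fob F (tgt C f)"
    by (auto simp: Hom_def)
qed

lemma farr_ide [simp]: "X \<in> ob C \<Longrightarrow> farr F (ide C X) = ide C (fob F X)"
  using is_functor by (simp add: is_functor_def)

lemma farr_cmp: "\<lbrakk>f \<in> arr C; g \<in> arr C; tgt C f = src C g\<rbrakk> \<Longrightarrow>
    farr F (g \<cdot> f) = farr F g \<cdot> farr F f"
  using is_functor by (simp add: is_functor_def)

lemma inverses_farr: "inverses f g \<Longrightarrow> inverses (farr F f) (farr F g)"
  by (auto simp: inverses_def farr_cmp[symmetric])

lemma isomorphic_fob: "isomorphic C X Y \<Longrightarrow> isomorphic C (fob F X) (fob F Y)"
  by (erule isomorphicE) (rule isomorphicI[OF inverses_farr], auto)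

end

text \<open>Half of an equivalence. It already makes \<open>F\<close> faithful and reflect
  isomorphism of objects; instantiated a second time with \<open>F\<close> and \<open>G\<close>
  exchanged, it gives the same for \<open>G\<close>.\<close>

locale endofunctor_retraction = endofunctor C F + G: endofunctor C G
  for C :: "('o, 'm, 'z) cat_data_scheme" (structure) and F G +
  assumes retraction: "naturally_isomorphic C C (comp_functor G F) id_functor"
begin

lemma obtain_natural_iso:
  obtains \<eta> \<epsilon> where
    "\<And>X. X \<in> ob C \<Longrightarrow> inverses (\<eta> X) (\<epsilon> X)"
    "\<And>X. X \<in> ob C \<Longrightarrow> src C (\<eta> X) = fob G (fob F X)"
    "\<And>X. X \<in> ob C \<Longrightarrow> tgt C (\<eta> X) = X"
    "\<And>f. f \<in> arr C \<Longrightarrow> \<eta> (tgt C f) \<cdot> farr G (farr F f) = f \<cdot> \<eta> (src C f)"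
proof -
  obtain \<eta> where \<eta>:
    "\<forall>X \<in> ob C. is_iso C (fob G (fob F X)) X (\<eta> X)"
    "\<forall>f \<in> arr C. \<eta> (tgt C f) \<cdot> farr G (farr F f) = f \<cdot> \<eta> (src C f)"
    using retraction unfolding naturally_isomorphic_def comp_functor_def id_functor_def
    by auto
  then have "\<forall>X. \<exists>g. X \<in> ob C \<longrightarrow> inverses (\<eta> X) g" unfolding is_iso_iff_inverses by blast
  then obtain \<epsilon> where "\<forall>X. X \<in> ob C \<longrightarrow> inverses (\<eta> X) (\<epsilon> X)" by metis
  with \<eta> show ?thesis using that[of \<eta> \<epsilon>] unfolding is_iso_iff_inverses by blast
qed

text \<open>By naturality the composite of \<open>f\<close> with the component of the natural
  isomorphism at its source is determined by \<open>farr F f\<close>, and that component can be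
  cancelled.\<close>

lemma faithful:
  assumes "f \<in> arr C" "g \<in> arr C" "src C f = src C g" "tgt C f = tgt C g" "farr F f = farr F g"
  shows "f = g"
proof (rule obtain_natural_iso)
  fix \<eta> \<epsilon> assume inv: "\<And>X. X \<in> ob C \<Longrightarrow> inverses (\<eta> X) (\<epsilon> X)"
    and tgt: "\<And>X. X \<in> ob C \<Longrightarrow> tgt C (\<eta> X) = X"
    and nat: "\<And>f. f \<in> arr C \<Longrightarrow> \<eta> (tgt C f) \<cdot> farr G (farr F f) = f \<cdot> \<eta> (src C f)"
  let ?X = "src C g"
  have "f \<cdot> \<eta> ?X = g \<cdot> \<eta> ?X" using nat[of f] nat[of g] assms by simp
  moreover have "inverses (\<epsilon> ?X) (\<eta> ?X)" "src C (\<epsilon> ?X) = ?X"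
    using inv[of ?X] tgt[of ?X] assms by (auto simp: inverses_def)
  moreover have "h = (h \<cdot> \<eta> ?X) \<cdot> \<epsilon> ?X" if "h \<in> arr C" "src C h = ?X" for h
    using cmp_inverses_right[of "\<epsilon> ?X" "\<eta> ?X" h] calculation that by simp
  ultimately show "f = g" using assms by metis
qed

lemma isomorphic_retract: "X \<in> ob C \<Longrightarrow> isomorphic C (fob G (fob F X)) X"
  by (rule obtain_natural_iso) (auto simp: isomorphic_iff)

lemma isomorphic_reflect:
  assumes "X \<in> ob C" "Y \<in> ob C" "isomorphic C (fob F X) (fob F Y)"
  shows "isomorphic C X Y"
  by (meson G.isomorphic_fob assms isomorphic_retract isomorphic_sym isomorphic_trans)

end

locale quasi_inverse_endofunctors = endofunctor_retraction C F G + G: endofunctor_retraction C G F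
  for C :: "('o, 'm, 'z) cat_data_scheme" (structure) and F G
begin

text \<open>The preimage is \<open>farr G h\<close> composed on both sides with the natural
  isomorphism. Naturality alone shows that its image and \<open>h\<close> agree after
  \<open>G\<close>; faithfulness of \<open>G\<close>, from the other retraction, then removes
  \<open>G\<close>.\<close>

lemma full:
  assumes "X \<in> ob C" "Y \<in> ob C" "h \<in> arr C" "src C h = fob F X" "tgt C h = fob F Y"
  obtains f where "f \<in> arr C" "src C f = X" "tgt C f = Y" "farr F f = h"
proof (rule obtain_natural_iso)
  fix \<eta> \<epsilon> assume inv: "\<And>X. X \<in> ob C \<Longrightarrow> inverses (\<eta> X) (\<epsilon> X)"
    and src: "\<And>X. X \<in> ob C \<Longrightarrow> src C (\<eta> X) = fob G (fob F X)"
    and tgt: "\<And>X. X \<in> ob C \<Longrightarrow> tgt C (\<eta> X) = X"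
    and nat: "\<And>f. f \<in> arr C \<Longrightarrow> \<eta> (tgt C f) \<cdot> farr G (farr F f) = f \<cdot> \<eta> (src C f)"
  note inv' = inv[unfolded inverses_def]
  let ?f = "\<eta> Y \<cdot> (farr G h \<cdot> \<epsilon> X)"
  have f: "?f \<in> arr C" "src C ?f = X" "tgt C ?f = Y"
    using assms inv'[of X] inv'[of Y] src tgt by auto
  have "\<eta> Y \<cdot> farr G (farr F ?f) = \<eta> Y \<cdot> farr G h"
    using nat[OF f(1)] f assms inv'[of X] inv'[of Y] src tgt by (simp add: assoc)
  then have "\<epsilon> Y \<cdot> (\<eta> Y \<cdot> farr G (farr F ?f)) = \<epsilon> Y \<cdot> (\<eta> Y \<cdot> farr G h)" by simp
  then have "farr G (farr F ?f) = farr G h"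
    using cmp_inverses[OF inv[of Y], of "farr G h"]
      cmp_inverses[OF inv[of Y], of "farr G (farr F ?f)"] f assms src by simp
  then have "farr F ?f = h" using G.faithful[of "farr F ?f" h] f assms by simp
  then show thesis using that f by blast
qed

text \<open>Faithfulness of \<open>G\<close> reduces the claim to arrows into
  \<open>fob G (fob F Z)\<close>, which is isomorphic to \<open>Z\<close> and hence zero. It is
  needed for squares that end at \<Sigma> Z.\<close>

lemma fob_zero_object:
  assumes "zero_object C Z" "f \<in> arr C" "g \<in> arr C" "src C f = src C g"
    "tgt C f = fob F Z" "tgt C g = fob F Z"
  shows "f = g"
proof -
  have Z: "Z \<in> ob C" using assms(1) by (simp add: zero_object_def)
  have "zero_object C (fob G (fob F Z))"
    by (rule zero_object_iso[OF assms(1) isomorphic_sym[OF isomorphic_retract[OF Z]]])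
  then have "farr G f = farr G g" by (rule zero_object_terminal) (use assms in auto)
  then show ?thesis using G.faithful[of f g] assms by simp
qed

end

text \<open>The inverse maps respect sources, targets, identities and composition because
  \<open>F\<close> respects them and is injective.\<close>

lemma (in endofunctor) automorphism_if_bij:
  assumes ob: "bij_betw (fob F) (ob C) (ob C)" and arr: "bij_betw (farr F) (arr C) (arr C)"
  shows "automorphism C F"
proof -
  define E where "E = \<lparr>fob = inv_into (ob C) (fob F), farr = inv_into (arr C) (farr F)\<rparr>"
  have FE_ob: "fob F (fob E X) = X" "fob E X \<in> ob C" if "X \<in> ob C" for X
    using that ob by (auto simp: E_def bij_betw_inv_into_right bij_betw_def inv_into_into)
  have EF_ob: "fob E (fob F X) = X" if "X \<in> ob C" for X
    using that ob by (simp add: E_def bij_betw_inv_into_left)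
  have FE_arr: "farr F (farr E f) = f" "farr E f \<in> arr C" if "f \<in> arr C" for f
    using that arr by (auto simp: E_def bij_betw_inv_into_right bij_betw_def inv_into_into)
  have EF_arr: "farr E (farr F f) = f" if "f \<in> arr C" for f
    using that arr by (simp add: E_def bij_betw_inv_into_left)
  have src: "src C (farr E f) = fob E (src C f)" if "f \<in> arr C" for f
    using EF_ob[of "src C (farr E f)"] src_farr[of "farr E f"] FE_arr[OF that] by simp
  have tgt: "tgt C (farr E f) = fob E (tgt C f)" if "f \<in> arr C" for f
    using EF_ob[of "tgt C (farr E f)"] tgt_farr[of "farr E f"] FE_arr[OF that] by simp
  have "farr E (ide C X) = ide C (fob E X)" if "X \<in> ob C" for X
    using EF_arr[of "ide C (fob E X)"] FE_ob[OF that] by simp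
  moreover have "farr E (g \<cdot> f) = farr E g \<cdot> farr E f"
    if "f \<in> arr C" "g \<in> arr C" "tgt C f = src C g" for f g
    using EF_arr[of "farr E g \<cdot> farr E f"] farr_cmp[of "farr E f" "farr E g"]
      src[OF that(2)] tgt[OF that(1)] FE_arr that by simp
  ultimately have "is_functor C C E"
    unfolding is_functor_def Hom_def using FE_ob FE_arr src tgt by auto
  then show ?thesis
    unfolding automorphism_def equal_functors_def comp_functor_def id_functor_def
    using is_functor FE_ob FE_arr EF_ob EF_arr by auto
qed

lemma (in category) autoequivalence_if_automorphism:
  assumes "automorphism C F"
  shows "autoequivalence C F"
proof -
  have id: "naturally_isomorphic C C H id_functor"
    if H: "is_functor C C H" and eq: "equal_functors C H id_functor" for H
  proof -
    interpret H: endofunctor C H by unfold_locales (rule H)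
    show ?thesis
      unfolding naturally_isomorphic_def using eq
      by (intro exI[of _ "ide C"])
        (auto simp: equal_functors_def id_functor_def is_iso_iff_inverses intro: inverses_ide)
  qed
  have comp: "is_functor C C (comp_functor H K)"
    if H: "is_functor C C H" and K: "is_functor C C K" for H K
  proof -
    interpret H: endofunctor C H by unfold_locales (rule H)
    interpret K: endofunctor C K by unfold_locales (rule K)
    show ?thesis
      by (auto simp: is_functor_def comp_functor_def Hom_def K.farr_cmp H.farr_cmp)
  qed
  show ?thesis using assms id comp unfolding automorphism_def autoequivalence_def by blast
qed


section \<open>Full subcategories and skeletons\<close>

lemma full_subcategory_simps [simp]:
  "ob (full_subcategory C S) = S"
  "f \<in> arr (full_subcategory C S) \<longleftrightarrow> f \<in> arr C \<and> src C f \<in> S \<and> tgt C f \<in> S"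
  "src (full_subcategory C S) = src C"
  "tgt (full_subcategory C S) = tgt C"
  "ide (full_subcategory C S) = ide C"
  "cmp (full_subcategory C S) = cmp C"
  by (simp_all add: full_subcategory_def)

lemma full_subcategory_add_simps [simp]:
  "hplus (full_subcategory C S) = hplus C"
  "hzero (full_subcategory C S) = hzero C"
  by (simp_all add: full_subcategory_def)

lemma Hom_full_subcategory [simp]:
  "\<lbrakk>X \<in> S; Y \<in> S\<rbrakk> \<Longrightarrow> Hom (full_subcategory C S) X Y = Hom C X Y"
  by (auto simp: Hom_def)

lemma isomorphic_full_subcategory:
  "\<lbrakk>X \<in> S; Y \<in> S\<rbrakk> \<Longrightarrow> isomorphic (full_subcategory C S) X Y \<longleftrightarrow> isomorphic C X Y"
  by (simp add: isomorphic_def is_iso_def)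

lemma hom_group_full_subcategory:
  "\<lbrakk>X \<in> S; Y \<in> S\<rbrakk> \<Longrightarrow> hom_group (full_subcategory C S) X Y = hom_group C X Y"
  by (simp add: hom_group_def)

lemma hneg_full_subcategory:
  "\<lbrakk>src C f \<in> S; tgt C f \<in> S\<rbrakk> \<Longrightarrow> hneg (full_subcategory C S) f = hneg C f"
  by (simp add: hneg_def hom_group_full_subcategory)

lemma is_biproduct_full_subcategory:
  "\<lbrakk>X \<in> S; Y \<in> S; Z \<in> S\<rbrakk> \<Longrightarrow>
    is_biproduct (full_subcategory C S) X Y Z i j p q \<longleftrightarrow> is_biproduct C X Y Z i j p q"
  by (simp add: is_biproduct_def)

lemma (in category) category_full_subcategory:
  "S \<subseteq> ob C \<Longrightarrow> category (full_subcategory C S)"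
  by unfold_locales (auto simp: Hom_def assoc)

section \<open>Chosen representatives in a skeleton\<close>

locale category_skeleton = category C
  for C :: "('o, 'm, 'z) cat_data_scheme" (structure) +
  fixes S :: "'o set"
  assumes S_ob: "S \<subseteq> ob C"
    and isomorphic_eq: "\<lbrakk>X \<in> S; Y \<in> S; isomorphic C X Y\<rbrakk> \<Longrightarrow> X = Y"
    and isomorphic_ex: "X \<in> ob C \<Longrightarrow> \<exists>Y \<in> S. isomorphic C X Y"
begin

abbreviation "B \<equiv> full_subcategory C S"

definition rep :: "'o \<Rightarrow> 'o" where
  "rep X = (SOME Y. Y \<in> S \<and> isomorphic C X Y)"

text \<open>The choice is normalised to the identity on \<open>S\<close> so that conjugating by
  these isomorphisms fixes every arrow of the skeleton. The construction for (F1c) depends on this,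
  since the first arrow is prescribed there.\<close>

definition to_rep :: "'o \<Rightarrow> 'm" where
  "to_rep X = (if X \<in> S then ide C X else SOME u. is_iso C X (rep X) u)"

definition from_rep :: "'o \<Rightarrow> 'm" where
  "from_rep X = (SOME v. inverses (to_rep X) v)"

lemma in_S_ob [simp]: "X \<in> S \<Longrightarrow> X \<in> ob C"
  using S_ob by blast

lemma rep_in_S [simp]: "X \<in> ob C \<Longrightarrow> rep X \<in> S"
  and isomorphic_rep: "X \<in> ob C \<Longrightarrow> isomorphic C X (rep X)"
  using someI_ex[of "\<lambda>Y. Y \<in> S \<and> isomorphic C X Y"] isomorphic_ex[of X]
  unfolding rep_def by blast+

lemma rep_eq: "X \<in> S \<Longrightarrow> rep X = X"
  using isomorphic_rep[of X] isomorphic_eq[of X "rep X"] by auto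

lemma rep_eq_iff: "\<lbrakk>X \<in> ob C; Y \<in> ob C\<rbrakk> \<Longrightarrow> rep X = rep Y \<longleftrightarrow> isomorphic C X Y"
  by (metis isomorphic_eq isomorphic_rep isomorphic_sym isomorphic_trans rep_in_S)

lemma is_iso_to_rep:
  assumes "X \<in> ob C"
  shows "is_iso C X (rep X) (to_rep X)"
proof (cases "X \<in> S")
  case True
  then show ?thesis using inverses_ide[of X] assms
    by (auto simp: to_rep_def rep_eq is_iso_iff_inverses)
next
  case False
  then show ?thesis using isomorphic_rep[OF assms] unfolding to_rep_def isomorphic_def
    by (simp add: someI_ex)
qed

lemma inverses_rep: "X \<in> ob C \<Longrightarrow> inverses (to_rep X) (from_rep X)"
  using is_iso_to_rep[of X] someI_ex[of "inverses (to_rep X)"]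
  unfolding is_iso_iff_inverses from_rep_def by auto

lemma to_rep_simps [simp]:
  assumes "X \<in> ob C"
  shows "to_rep X \<in> arr C" "src C (to_rep X) = X" "tgt C (to_rep X) = rep X"
  using is_iso_to_rep[OF assms] by (auto simp: is_iso_iff_inverses inverses_def)

lemma from_rep_simps [simp]:
  assumes "X \<in> ob C"
  shows "from_rep X \<in> arr C" "src C (from_rep X) = rep X" "tgt C (from_rep X) = X"
  using inverses_rep[OF assms] assms by (auto simp: inverses_def)

lemma cmp_rep [simp]:
  assumes "X \<in> ob C"
  shows "from_rep X \<cdot> to_rep X = ide C X" "to_rep X \<cdot> from_rep X = ide C (rep X)"
    "\<lbrakk>f \<in> arr C; tgt C f = X\<rbrakk> \<Longrightarrow> from_rep X \<cdot> (to_rep X \<cdot> f) = f"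
    "\<lbrakk>f \<in> arr C; tgt C f = rep X\<rbrakk> \<Longrightarrow> to_rep X \<cdot> (from_rep X \<cdot> f) = f"
  using inverses_rep[OF assms] cmp_inverses[OF inverses_rep[OF assms], of f]
    cmp_inverses[OF inverses_sym[OF inverses_rep[OF assms]], of f] assms
  by (simp_all add: inverses_def)

lemma to_rep_eq: "X \<in> S \<Longrightarrow> to_rep X = ide C X"
  by (simp add: to_rep_def)

lemma from_rep_eq: "X \<in> S \<Longrightarrow> from_rep X = ide C X"
  using cmp_rep(1)[of X] by (simp add: to_rep_eq rep_eq)

lemma category_B: "category B"
  by (rule category_full_subcategory[OF S_ob])

text \<open>Universality in \<open>B\<close> is tested against objects of \<open>S\<close> only. An
  arbitrary \<open>Y\<close> is reached through \<open>to_rep Y\<close> and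
  \<open>from_rep Y\<close>, which turn arrows at \<open>Y\<close> into arrows at
  \<open>rep Y\<close> and back.\<close>

lemma zero_object_B:
  assumes Z: "Z \<in> S"
  shows "zero_object B Z \<longleftrightarrow> zero_object C Z"
proof
  assume "zero_object C Z"
  then show "zero_object B Z" using Z by (simp add: zero_object_def)
next
  assume zero: "zero_object B Z"
  interpret B: category B by (rule category_B)
  have "\<exists>!f. f \<in> Hom C Z Y" if Y: "Y \<in> ob C" for Y
  proof -
    obtain h where h: "h \<in> arr C" "src C h = Z" "tgt C h = rep Y"
      using B.zero_object_arr_from[OF zero, of "rep Y"] Y by auto
    show ?thesis
    proof (rule ex1I[of _ "from_rep Y \<cdot> h"])
      show "from_rep Y \<cdot> h \<in> Hom C Z Y" using h Y by (simp add: Hom_def)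
      fix k assume "k \<in> Hom C Z Y"
      then have k: "k \<in> arr C" "src C k = Z" "tgt C k = Y" by (simp_all add: Hom_def)
      have "to_rep Y \<cdot> k = h"
        by (rule B.zero_object_initial[OF zero]) (use h k Z Y in simp_all)
      then show "k = from_rep Y \<cdot> h" using cmp_rep(3)[OF Y k(1) k(3)] by simp
    qed
  qed
  moreover have "\<exists>!f. f \<in> Hom C Y Z" if Y: "Y \<in> ob C" for Y
  proof -
    obtain h where h: "h \<in> arr C" "src C h = rep Y" "tgt C h = Z"
      using B.zero_object_arr_to[OF zero, of "rep Y"] Y by auto
    show ?thesis
    proof (rule ex1I[of _ "h \<cdot> to_rep Y"])
      show "h \<cdot> to_rep Y \<in> Hom C Y Z" using h Y by (simp add: Hom_def)
      fix k assume "k \<in> Hom C Y Z"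
      then have k: "k \<in> arr C" "src C k = Y" "tgt C k = Z" by (simp_all add: Hom_def)
      have "k \<cdot> from_rep Y = h"
        by (rule B.zero_object_terminal[OF zero]) (use h k Z Y in simp_all)
      then show "k = h \<cdot> to_rep Y"
        using assoc[of "to_rep Y" "from_rep Y" k] k Y by simp
    qed
  qed
  ultimately show "zero_object C Z" using Z by (simp add: zero_object_def)
qed

end


section \<open>The autoequivalence of a skeleton\<close>

locale skeleton_autoequivalence = category_skeleton C S + quasi_inverse_endofunctors C \<Sigma> \<Gamma>
  for C :: "('o, 'm, 'z) cat_data_scheme" (structure) and S \<Sigma> \<Gamma>
begin

definition \<Sigma>\<^sub>S :: "('o, 'm, 'o, 'm) cat_functor" where
  "\<Sigma>\<^sub>S = \<lparr>fob = (\<lambda>X. rep (fob \<Sigma> X)),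
    farr = (\<lambda>f. to_rep (fob \<Sigma> (tgt C f)) \<cdot> (farr \<Sigma> f \<cdot> from_rep (fob \<Sigma> (src C f))))\<rparr>"

lemma fob_\<Sigma>\<^sub>S [simp]: "fob \<Sigma>\<^sub>S X = rep (fob \<Sigma> X)"
  by (simp add: \<Sigma>\<^sub>S_def)

lemma \<Sigma>\<^sub>S_simps [simp]:
  assumes "f \<in> arr C"
  shows "farr \<Sigma>\<^sub>S f \<in> arr C"
    "src C (farr \<Sigma>\<^sub>S f) = rep (fob \<Sigma> (src C f))"
    "tgt C (farr \<Sigma>\<^sub>S f) = rep (fob \<Sigma> (tgt C f))"
  using assms by (simp_all add: \<Sigma>\<^sub>S_def)

text \<open>Naturality of the comparison from \<open>\<Sigma>\<^sub>S\<close> to \<Sigma>. All later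
  squares that mix the two functors rest on it.\<close>

lemma from_rep_natural:
  assumes "f \<in> arr C" "tgt C f = Y"
  shows "from_rep (fob \<Sigma> Y) \<cdot> farr \<Sigma>\<^sub>S f = farr \<Sigma> f \<cdot> from_rep (fob \<Sigma> (src C f))"
  using assms by (auto simp: \<Sigma>\<^sub>S_def)

lemma farr_\<Sigma>_eq:
  assumes "f \<in> arr C"
  shows "farr \<Sigma> f = from_rep (fob \<Sigma> (tgt C f)) \<cdot> (farr \<Sigma>\<^sub>S f \<cdot> to_rep (fob \<Sigma> (src C f)))"
  using assms by (simp add: \<Sigma>\<^sub>S_def assoc)

lemma endofunctor_\<Sigma>\<^sub>S: "endofunctor B \<Sigma>\<^sub>S"
proof -
  interpret B: category B by (rule category_B)
  show ?thesis
    by unfold_locales (auto simp: is_functor_def Hom_def \<Sigma>\<^sub>S_def farr_cmp assoc)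
qed

text \<open>An equivalence is injective and surjective on objects up to isomorphism, and in a
  skeleton isomorphism is equality. On arrows, bijectivity then comes from \<Sigma> being full and
  faithful.\<close>

lemma automorphism_\<Sigma>\<^sub>S: "automorphism B \<Sigma>\<^sub>S"
proof -
  interpret B: endofunctor B \<Sigma>\<^sub>S by (rule endofunctor_\<Sigma>\<^sub>S)
  have inj_ob: "X = Y" if "X \<in> S" "Y \<in> S" "rep (fob \<Sigma> X) = rep (fob \<Sigma> Y)" for X Y
  proof -
    have "isomorphic C (fob \<Sigma> X) (fob \<Sigma> Y)" using that by (simp add: rep_eq_iff)
    then show ?thesis using isomorphic_reflect[of X Y] isomorphic_eq[of X Y] that by simp
  qed
  \<comment> \<open>The preimage of \<open>Y\<close> is the representative of
    \<open>fob \<Gamma> Y\<close>, because \<Sigma> maps it to an object isomorphic to \<Sigma>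
    \<Gamma> Y, hence to \<open>Y\<close>.\<close>
  have surj_ob: "\<exists>X \<in> S. rep (fob \<Sigma> X) = Y" if Y: "Y \<in> S" for Y
  proof (rule bexI[of _ "rep (fob \<Gamma> Y)"])
    have "isomorphic C (fob \<Sigma> (rep (fob \<Gamma> Y))) (fob \<Sigma> (fob \<Gamma> Y))"
      using Y by (intro isomorphic_fob isomorphic_sym[OF isomorphic_rep]) simp
    then have "isomorphic C (fob \<Sigma> (rep (fob \<Gamma> Y))) Y"
      using G.isomorphic_retract[of Y] isomorphic_trans Y in_S_ob by blast
    then show "rep (fob \<Sigma> (rep (fob \<Gamma> Y))) = Y"
      using rep_eq_iff[of "fob \<Sigma> (rep (fob \<Gamma> Y))" Y] rep_eq[of Y] Y by simp
  qed (use Y in simp)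
  show ?thesis
  proof (rule B.automorphism_if_bij)
    show "bij_betw (fob \<Sigma>\<^sub>S) (ob B) (ob B)"
      by (rule bij_betw_imageI) (use surj_ob in \<open>auto intro!: inj_onI intro: inj_ob\<close>)
    have "inj_on (farr \<Sigma>\<^sub>S) (arr B)"
    proof (rule inj_onI)
      fix f g assume fg: "f \<in> arr B" "g \<in> arr B" and eq: "farr \<Sigma>\<^sub>S f = farr \<Sigma>\<^sub>S g"
      \<comment> \<open>Faithfulness compares parallel arrows only, so the endpoints are identified
        first, by injectivity on objects.\<close>
      have "rep (fob \<Sigma> (src C f)) = rep (fob \<Sigma> (src C g))"
        "rep (fob \<Sigma> (tgt C f)) = rep (fob \<Sigma> (tgt C g))"
        using fg \<Sigma>\<^sub>S_simps[of f] \<Sigma>\<^sub>S_simps[of g] eq by simp_all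
      then have par: "src C f = src C g" "tgt C f = tgt C g" using fg by (auto intro: inj_ob)
      then have "farr \<Sigma> f = farr \<Sigma> g" using farr_\<Sigma>_eq[of f] farr_\<Sigma>_eq[of g] eq fg by simp
      then show "f = g" using faithful[of f g] par fg by simp
    qed
    moreover have "\<exists>f \<in> arr B. farr \<Sigma>\<^sub>S f = g" if g: "g \<in> arr B" for g
    proof -
      obtain X Y where X: "X \<in> S" "rep (fob \<Sigma> X) = src C g" and Y: "Y \<in> S" "rep (fob \<Sigma> Y) = tgt C g"
        using surj_ob[of "src C g"] surj_ob[of "tgt C g"] g by auto
      \<comment> \<open>Undoing the conjugation turns \<open>g\<close> into an arrow from \<Sigma> X
        to \<Sigma> Y, which fullness lifts to an arrow from \<open>X\<close> to
        \<open>Y\<close>.\<close>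
      let ?h = "from_rep (fob \<Sigma> Y) \<cdot> (g \<cdot> to_rep (fob \<Sigma> X))"
      have h: "?h \<in> arr C" "src C ?h = fob \<Sigma> X" "tgt C ?h = fob \<Sigma> Y" using X Y g by simp_all
      obtain f where f: "f \<in> arr C" "src C f = X" "tgt C f = Y" "farr \<Sigma> f = ?h"
        using full[OF _ _ h] X Y by auto
      have "farr \<Sigma>\<^sub>S f = g" using f X Y g by (simp add: \<Sigma>\<^sub>S_def assoc)
      then show ?thesis using f X Y by (intro bexI[of _ f]) simp_all
    qed
    ultimately show "bij_betw (farr \<Sigma>\<^sub>S) (arr B) (arr B)"
      by (intro bij_betw_imageI) (auto simp del: full_subcategory_simps(2))
  qed
qed

end


section \<open>Preadditive and additive categories\<close>

context preadditive_category
begin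

lemma hplus_simps [simp]:
  assumes "f \<in> arr C" "g \<in> arr C" "src C f = src C g" "tgt C f = tgt C g"
  shows "f \<boxplus> g \<in> arr C" "src C (f \<boxplus> g) = src C g" "tgt C (f \<boxplus> g) = tgt C g"
proof -
  interpret H: comm_group "hom_group C (src C g) (tgt C g)"
    by (rule hom_comm_group) (use assms in simp_all)
  show "f \<boxplus> g \<in> arr C" "src C (f \<boxplus> g) = src C g" "tgt C (f \<boxplus> g) = tgt C g"
    using H.m_closed[of f g] assms by (simp_all add: hom_group_def Hom_def)
qed

lemma hzero_simps [simp]:
  assumes "X \<in> ob C" "Y \<in> ob C"
  shows "hzero C X Y \<in> arr C" "src C (hzero C X Y) = X" "tgt C (hzero C X Y) = Y"
proof -
  interpret H: comm_group "hom_group C X Y" by (rule hom_comm_group) (use assms in simp_all)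
  show "hzero C X Y \<in> arr C" "src C (hzero C X Y) = X" "tgt C (hzero C X Y) = Y"
    using H.one_closed by (simp_all add: hom_group_def Hom_def)
qed

text \<open>In a group only the neutral element is idempotent. With distributivity this shows that
  composites with zero arrows are zero.\<close>

lemma hzero_if_idem:
  assumes "f \<in> arr C" "f \<boxplus> f = f"
  shows "f = hzero C (src C f) (tgt C f)"
proof -
  interpret H: comm_group "hom_group C (src C f) (tgt C f)"
    by (rule hom_comm_group) (use assms in simp_all)
  show ?thesis using H.l_cancel_one'[of f f] assms by (simp add: hom_group_def Hom_def)
qed

lemma hplus_hzero [simp]:
  assumes "f \<in> arr C" "src C f = X" "tgt C f = Y"
  shows "f \<boxplus> hzero C X Y = f"
proof -
  interpret H: comm_group "hom_group C X Y"
    by (rule hom_comm_group) (use assms src_in_ob[of f] tgt_in_ob[of f] in simp_all)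
  show ?thesis using H.r_one[of f] assms by (simp add: hom_group_def Hom_def)
qed

lemma cmp_hplus:
  assumes "f \<in> arr C" "f' \<in> arr C" "g \<in> arr C" "src C f = src C f'" "tgt C f = src C g" "tgt C f' = src C g"
  shows "g \<cdot> (f \<boxplus> f') = g \<cdot> f \<boxplus> g \<cdot> f'"
  by (rule cmp_hplus_right[of _ "src C f" "src C g" _ _ "tgt C g"]) (use assms in \<open>simp_all add: Hom_def\<close>)

lemma hplus_cmp:
  assumes "f \<in> arr C" "g \<in> arr C" "g' \<in> arr C" "tgt C f = src C g" "src C g' = src C g" "tgt C g' = tgt C g"
  shows "(g \<boxplus> g') \<cdot> f = g \<cdot> f \<boxplus> g' \<cdot> f"
  by (rule cmp_hplus_left[of _ "src C f" "src C g" _ "tgt C g"]) (use assms in \<open>simp_all add: Hom_def\<close>)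

lemma hzero_hplus_hzero: "\<lbrakk>X \<in> ob C; Y \<in> ob C\<rbrakk> \<Longrightarrow> hzero C X Y \<boxplus> hzero C X Y = hzero C X Y"
  by simp

lemma cmp_hzero [simp]:
  assumes "g \<in> arr C" "X \<in> ob C" "src C g = Y"
  shows "g \<cdot> hzero C X Y = hzero C X (tgt C g)"
proof -
  have Y: "Y \<in> ob C" using src_in_ob[OF assms(1)] assms(3) by simp
  have "g \<cdot> hzero C X Y \<boxplus> g \<cdot> hzero C X Y = g \<cdot> hzero C X Y"
    using cmp_hplus[of "hzero C X Y" "hzero C X Y" g] assms Y by (simp add: hzero_hplus_hzero)
  then show ?thesis using hzero_if_idem[of "g \<cdot> hzero C X Y"] assms Y by simp
qed

lemma hzero_cmp [simp]:
  assumes "f \<in> arr C" "Z \<in> ob C" "tgt C f = Y"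
  shows "hzero C Y Z \<cdot> f = hzero C (src C f) Z"
proof -
  have Y: "Y \<in> ob C" using tgt_in_ob[OF assms(1)] assms(3) by simp
  have "hzero C Y Z \<cdot> f \<boxplus> hzero C Y Z \<cdot> f = hzero C Y Z \<cdot> f"
    using hplus_cmp[of f "hzero C Y Z" "hzero C Y Z"] assms Y by (simp add: hzero_hplus_hzero)
  then show ?thesis using hzero_if_idem[of "hzero C Y Z \<cdot> f"] assms Y by simp
qed

lemma hneg_simps [simp]:
  assumes "f \<in> arr C"
  shows "hneg C f \<in> arr C" "src C (hneg C f) = src C f" "tgt C (hneg C f) = tgt C f"
    "hneg C f \<boxplus> f = hzero C (src C f) (tgt C f)"
proof -
  interpret H: comm_group "hom_group C (src C f) (tgt C f)"
    by (rule hom_comm_group) (use assms in simp_all)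
  show "hneg C f \<in> arr C" "src C (hneg C f) = src C f" "tgt C (hneg C f) = tgt C f"
    "hneg C f \<boxplus> f = hzero C (src C f) (tgt C f)"
    using H.inv_closed[of f] H.l_inv[of f] assms
    by (simp_all add: hom_group_def Hom_def hneg_def)
qed

lemma hneg_unique:
  assumes "f \<in> arr C" "g \<in> arr C" "src C g = src C f" "tgt C g = tgt C f"
    "g \<boxplus> f = hzero C (src C f) (tgt C f)"
  shows "hneg C f = g"
proof -
  interpret H: comm_group "hom_group C (src C f) (tgt C f)"
    by (rule hom_comm_group) (use assms in simp_all)
  show ?thesis using H.inv_equality[of g f] assms by (simp add: hom_group_def Hom_def hneg_def)
qed

lemma cmp_hneg:
  assumes "f \<in> arr C" "g \<in> arr C" "tgt C f = src C g"
  shows "g \<cdot> hneg C f = hneg C (g \<cdot> f)"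
proof (rule hneg_unique[symmetric])
  have "g \<cdot> hneg C f \<boxplus> g \<cdot> f = g \<cdot> (hneg C f \<boxplus> f)"
    by (rule cmp_hplus[symmetric]) (use assms in simp_all)
  also have "\<dots> = hzero C (src C f) (tgt C g)" using assms hneg_simps(4)[OF assms(1)] by simp
  finally show "g \<cdot> hneg C f \<boxplus> g \<cdot> f = hzero C (src C (g \<cdot> f)) (tgt C (g \<cdot> f))"
    using assms by simp
qed (use assms in simp_all)

lemma hneg_cmp:
  assumes "f \<in> arr C" "g \<in> arr C" "tgt C f = src C g"
  shows "hneg C g \<cdot> f = hneg C (g \<cdot> f)"
proof (rule hneg_unique[symmetric])
  have "hneg C g \<cdot> f \<boxplus> g \<cdot> f = (hneg C g \<boxplus> g) \<cdot> f"
    by (rule hplus_cmp[symmetric]) (use assms in simp_all)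
  also have "\<dots> = hzero C (src C f) (tgt C g)" using assms hneg_simps(4)[OF assms(2)] by simp
  finally show "hneg C g \<cdot> f \<boxplus> g \<cdot> f = hzero C (src C (g \<cdot> f)) (tgt C (g \<cdot> f))"
    using assms by simp
qed (use assms in simp_all)

lemma preadditive_full_subcategory:
  assumes "S \<subseteq> ob C"
  shows "preadditive_category (full_subcategory C S)"
proof -
  interpret B: category "full_subcategory C S" by (rule category_full_subcategory[OF assms])
  show ?thesis
  proof (intro preadditive_category.intro B.category_axioms preadditive_category_axioms.intro)
    fix X Y assume "X \<in> ob (full_subcategory C S)" "Y \<in> ob (full_subcategory C S)"
    then show "comm_group (hom_group (full_subcategory C S) X Y)"
      using hom_comm_group[of X Y] assms by (auto simp: hom_group_full_subcategory)
  qed (auto simp: Hom_def cmp_hplus hplus_cmp)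
qed

section \<open>Biproducts along isomorphisms of the sum or of a summand\<close>

lemma is_biproduct_iso:
  assumes "is_biproduct C X Y Z i j p q" "inverses u v" "src C u = Z"
  shows "is_biproduct C X Y (tgt C u) (u \<cdot> i) (u \<cdot> j) (p \<cdot> v) (q \<cdot> v)"
proof -
  have b: "i \<in> arr C" "j \<in> arr C" "p \<in> arr C" "q \<in> arr C" "src C i = X" "src C j = Y"
    "tgt C i = Z" "tgt C j = Z" "src C p = Z" "src C q = Z" "tgt C p = X" "tgt C q = Y"
    "p \<cdot> i = ide C X" "q \<cdot> j = ide C Y" "p \<cdot> j = hzero C Y X" "q \<cdot> i = hzero C X Y"
    "i \<cdot> p \<boxplus> j \<cdot> q = ide C Z"
    using assms(1) by (simp_all add: is_biproduct_def Hom_def)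
  have u: "u \<in> arr C" "v \<in> arr C" "src C v = tgt C u" "tgt C v = Z" "u \<cdot> v = ide C (tgt C u)"
    using assms(2,3) by (simp_all add: inverses_def)
  have vu: "v \<cdot> (u \<cdot> f) = f" if "f \<in> arr C" "tgt C f = Z" for f
    using cmp_inverses[OF assms(2), of f] that assms(3) by simp
  have "u \<cdot> ((i \<cdot> p \<boxplus> j \<cdot> q) \<cdot> v) = u \<cdot> (i \<cdot> (p \<cdot> v)) \<boxplus> u \<cdot> (j \<cdot> (q \<cdot> v))"
    using b(1-12) u assms(3) by (simp add: cmp_hplus hplus_cmp assoc)
  moreover have "u \<cdot> ((i \<cdot> p \<boxplus> j \<cdot> q) \<cdot> v) = ide C (tgt C u)" using b(17) u by simp
  ultimately show ?thesis
    using b(1-16) u assms(3) by (simp add: is_biproduct_def Hom_def assoc vu)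
qed

text \<open>Needed for the last biproduct of a cone, whose left summand
  \<open>\<Sigma>\<^sub>S\<close> X^0 has to be exchanged for \<Sigma> X^0.\<close>

lemma is_biproduct_iso_left:
  assumes "is_biproduct C X Y Z i j p q" "inverses u v" "tgt C u = X"
  shows "is_biproduct C (src C u) Y Z (i \<cdot> u) j (v \<cdot> p) q"
proof -
  have b: "i \<in> arr C" "j \<in> arr C" "p \<in> arr C" "q \<in> arr C" "src C i = X" "src C j = Y"
    "tgt C i = Z" "tgt C j = Z" "src C p = Z" "src C q = Z" "tgt C p = X" "tgt C q = Y"
    "p \<cdot> i = ide C X" "q \<cdot> j = ide C Y" "p \<cdot> j = hzero C Y X" "q \<cdot> i = hzero C X Y"
    "i \<cdot> p \<boxplus> j \<cdot> q = ide C Z"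
    using assms(1) by (simp_all add: is_biproduct_def Hom_def)
  have u: "u \<in> arr C" "v \<in> arr C" "src C v = X" "tgt C v = src C u" "v \<cdot> u = ide C (src C u)"
    using assms(2,3) by (simp_all add: inverses_def)
  have ob: "Y \<in> ob C" "src C u \<in> ob C"
    using src_in_ob[OF b(2)] src_in_ob[OF u(1)] b(6) by simp_all
  have uv: "u \<cdot> (v \<cdot> f) = f" if "f \<in> arr C" "tgt C f = X" for f
    using cmp_inverses[OF inverses_sym[OF assms(2)], of f] that u by simp
  have pi: "p \<cdot> (i \<cdot> f) = f" if "f \<in> arr C" "tgt C f = X" for f
    using assoc[of f i p] b that by simp
  have qi: "q \<cdot> (i \<cdot> f) = hzero C (src C f) Y" if "f \<in> arr C" "tgt C f = X" for f
    using assoc[of f i q] b that ob by simp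
  show ?thesis
    using b u assms(3) ob by (simp add: is_biproduct_def Hom_def assoc uv pi qi)
qed

end

lemma (in additive_category) additive_skeleton:
  assumes "category_skeleton C S"
  shows "additive_category (full_subcategory C S)"
proof -
  interpret category_skeleton C S by (rule assms)
  interpret B: preadditive_category B by (rule preadditive_full_subcategory[OF S_ob])
  show ?thesis
  proof unfold_locales
    obtain Z where Z: "zero_object C Z" using has_zero_object by blast
    then have "Z \<in> ob C" by (simp add: zero_object_def)
    then show "\<exists>Z. zero_object B Z"
      using zero_object_iso[OF Z isomorphic_rep] by (intro exI[of _ "rep Z"]) (simp add: zero_object_B)
  next
    fix X Y assume "X \<in> ob B" "Y \<in> ob B"
    then have XY: "X \<in> S" "Y \<in> S" by simp_all
    obtain Z i j p q where Z: "Z \<in> ob C" "is_biproduct C X Y Z i j p q"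
      using has_biproducts[of X Y] XY by auto
    have "is_biproduct C X Y (rep Z) (to_rep Z \<cdot> i) (to_rep Z \<cdot> j) (p \<cdot> from_rep Z) (q \<cdot> from_rep Z)"
      using is_biproduct_iso[OF Z(2) inverses_rep[OF Z(1)]] Z(1) by simp
    then have "is_biproduct B X Y (rep Z) (to_rep Z \<cdot> i) (to_rep Z \<cdot> j) (p \<cdot> from_rep Z) (q \<cdot> from_rep Z)"
      using XY Z(1) by (simp add: is_biproduct_full_subcategory)
    then show "\<exists>Z \<in> ob B. \<exists>i j p q. is_biproduct B X Y Z i j p q"
      using Z(1) by (intro bexI[of _ "rep Z"]) auto
  qed
qed


section \<open>Sequences\<close>

lemma (in category) sigma_sequence_iff:
  "sigma_sequence n C \<Sigma> x \<longleftrightarrow> length x = n + 2 \<and> (\<forall>k \<le> Suc n. x ! k \<in> arr C) \<and>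
    (\<forall>k \<le> n. tgt C (x ! k) = src C (x ! Suc k)) \<and> tgt C (x ! Suc n) = fob \<Sigma> (src C (x ! 0))"
  unfolding sigma_sequence_def subset_eq all_set_conv_all_nth
  by (auto simp: less_Suc_eq_le)

lemma (in category) seq_morphism_iff:
  "seq_morphism n C \<Sigma> x y f \<longleftrightarrow>
    (\<forall>k \<le> Suc n. f k \<in> arr C \<and> src C (f k) = src C (x ! k) \<and> tgt C (f k) = src C (y ! k)) \<and>
    (\<forall>k \<le> n. f (Suc k) \<cdot> x ! k = y ! k \<cdot> f k) \<and>
    farr \<Sigma> (f 0) \<cdot> x ! Suc n = y ! Suc n \<cdot> f (Suc n)"
  by (simp add: seq_morphism_def Hom_def)

lemma (in category) square_inverses:
  assumes "inverses f g" "inverses f' g'" "f' \<cdot> a = b \<cdot> f" "a \<in> arr C" "b \<in> arr C"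
    "src C f = src C a" "src C f' = tgt C a" "tgt C f = src C b" "tgt C f' = tgt C b"
  shows "g' \<cdot> b = a \<cdot> g"
proof -
  have f: "f \<in> arr C" "g \<in> arr C" "src C g = src C b" "tgt C g = src C a" "f \<cdot> g = ide C (src C b)"
    using assms by (simp_all add: inverses_def)
  have f': "f' \<in> arr C" "g' \<in> arr C" "src C g' = tgt C b" "tgt C g' = tgt C a"
    using assms by (simp_all add: inverses_def)
  have "a \<cdot> g = g' \<cdot> (f' \<cdot> (a \<cdot> g))"
    by (rule cmp_inverses[OF assms(2), symmetric]) (use assms(4-) f in simp_all)
  also have "f' \<cdot> (a \<cdot> g) = (f' \<cdot> a) \<cdot> g"
    by (rule assoc[symmetric]) (use assms(4-) f f' in simp_all)
  also have "\<dots> = (b \<cdot> f) \<cdot> g" using assms(3) by simp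
  also have "\<dots> = b \<cdot> (f \<cdot> g)"
    by (rule assoc) (use assms(4-) f f' in simp_all)
  also have "\<dots> = b" using f assms(5) by simp
  finally show ?thesis by simp
qed

lemma (in endofunctor) seq_morphism_inverses:
  assumes x: "sigma_sequence n C F x" and y: "sigma_sequence n C F y" and f: "seq_morphism n C F x y f"
    and inv: "\<And>k. k \<le> Suc n \<Longrightarrow> inverses (f k) (g k)"
  shows "seq_morphism n C F y x g"
proof -
  have inv_F: "inverses (farr F (f 0)) (farr F (g 0))" by (rule inverses_farr[OF inv]) simp
  have "g (Suc k) \<cdot> y ! k = x ! k \<cdot> g k" if "k \<le> n" for k
    by (rule square_inverses[OF inv inv, where a = "x ! k"])
      (use x y f that in \<open>simp_all add: sigma_sequence_iff seq_morphism_iff\<close>)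
  moreover have "farr F (g 0) \<cdot> y ! Suc n = x ! Suc n \<cdot> g (Suc n)"
    by (rule square_inverses[OF inv inv_F])
      (use x y f in \<open>simp_all add: sigma_sequence_iff seq_morphism_iff\<close>)
  ultimately show ?thesis
    using inv f by (simp add: seq_morphism_iff inverses_def)
qed

section \<open>Closure of \<T> under isomorphism\<close>

context weak_pre_angulated_category
begin

lemma obtain_quasi_inverse:
  obtains \<Gamma> where "quasi_inverse_endofunctors C \<Sigma> \<Gamma>"
proof -
  obtain \<Gamma> where "is_functor C C \<Sigma>" "is_functor C C \<Gamma>"
    "naturally_isomorphic C C (comp_functor \<Gamma> \<Sigma>) id_functor"
    "naturally_isomorphic C C (comp_functor \<Sigma> \<Gamma>) id_functor"
    using autoequivalence unfolding autoequivalence_def by blast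
  then have "quasi_inverse_endofunctors C \<Sigma> \<Gamma>" by unfold_locales
  then show thesis by (rule that)
qed

text \<open>A sequence isomorphic to \<open>x\<close> is a direct sum of \<open>x\<close> and a sequence of zero objects.\<close>

lemma iso_closed:
  assumes x: "x \<in> \<T>" and y: "sigma_sequence n C \<Sigma> y" and f: "seq_morphism n C \<Sigma> x y f"
    and inv: "\<And>k. k \<le> Suc n \<Longrightarrow> inverses (f k) (g k)"
  shows "y \<in> \<T>"
proof (rule obtain_quasi_inverse)
  fix \<Gamma> assume "quasi_inverse_endofunctors C \<Sigma> \<Gamma>"
  then interpret quasi_inverse_endofunctors C \<Sigma> \<Gamma> .
  have seq_x: "sigma_sequence n C \<Sigma> x" by (rule sequences[OF x])
  have g: "seq_morphism n C \<Sigma> y x g" by (rule seq_morphism_inverses[OF seq_x y f inv])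
  obtain Z where Z: "zero_object C Z" using has_zero_object by blast
  then have Z_ob: "Z \<in> ob C" by (simp add: zero_object_def)
  \<comment> \<open>\<Sigma> Z need not equal \<open>Z\<close>, so the sequence of zero objects
    cannot end in an identity; its last arrow is some arrow from \<open>Z\<close> to \<Sigma>
    Z.\<close>
  obtain \<zeta> where \<zeta>: "\<zeta> \<in> arr C" "src C \<zeta> = Z" "tgt C \<zeta> = fob \<Sigma> Z"
    using zero_object_arr_from[OF Z fob_in_ob[OF Z_ob]] by blast
  define z where "z = replicate (Suc n) (ide C Z) @ [\<zeta>]"
  have z_nth: "k \<le> n \<Longrightarrow> z ! k = ide C Z" "z ! Suc n = \<zeta>" for k
    by (simp_all add: z_def nth_append del: replicate_Suc)
  have z_src: "k \<le> Suc n \<Longrightarrow> z ! k \<in> arr C \<and> src C (z ! k) = Z" for k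
    using z_nth Z_ob \<zeta> by (cases "k = Suc n") auto
  have seq_z: "sigma_sequence n C \<Sigma> z"
  proof -
    have "length z = n + 2" by (simp add: z_def)
    then show ?thesis using z_src z_nth \<zeta> Z_ob by (simp add: sigma_sequence_iff)
  qed
  have "z \<in> \<T>" using F1a_zero[OF seq_z] z_src Z by simp
  moreover have "seq_direct_sum n C \<Sigma> x z y"
  proof -
    \<comment> \<open>The zero summand is included and projected by zero arrows; \<open>f\<close>
      and \<open>g\<close> serve for the summand \<open>x\<close>.\<close>
    define j where "j k = hzero C Z (src C (y ! k))" for k
    define q where "q k = hzero C (src C (y ! k)) Z" for k
    have y': "k \<le> Suc n \<Longrightarrow> y ! k \<in> arr C" "k \<le> n \<Longrightarrow> tgt C (y ! k) = src C (y ! Suc k)"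
      "tgt C (y ! Suc n) = fob \<Sigma> (src C (y ! 0))" for k
      using y by (auto simp: sigma_sequence_iff)
    have fk: "k \<le> Suc n \<Longrightarrow> f k \<in> arr C \<and> g k \<in> arr C \<and> src C (f k) = src C (x ! k) \<and>
      tgt C (f k) = src C (y ! k) \<and> src C (g k) = src C (y ! k) \<and> tgt C (g k) = src C (x ! k) \<and>
      g k \<cdot> f k = ide C (src C (x ! k)) \<and> f k \<cdot> g k = ide C (src C (y ! k))" for k
      using inv[of k] f by (simp add: inverses_def seq_morphism_iff)
    have "seq_morphism n C \<Sigma> z y j"
      unfolding seq_morphism_iff
    proof (intro conjI allI impI)
      show "farr \<Sigma> (j 0) \<cdot> z ! Suc n = y ! Suc n \<cdot> j (Suc n)"
        by (rule zero_object_initial[OF Z]) (use z_nth \<zeta> y' Z_ob in \<open>simp_all add: j_def\<close>)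
    qed (use z_src z_nth y' Z_ob in \<open>simp_all add: j_def\<close>)
    moreover have "seq_morphism n C \<Sigma> y z q"
      unfolding seq_morphism_iff
    proof (intro conjI allI impI)
      \<comment> \<open>In contrast to the corresponding square for \<open>j\<close>, which starts
        at \<open>Z\<close>, this one ends at \<Sigma> Z, so uniqueness of arrows into the image of
        a zero object is required.\<close>
      show "farr \<Sigma> (q 0) \<cdot> y ! Suc n = z ! Suc n \<cdot> q (Suc n)"
        by (rule fob_zero_object[OF Z]) (use z_nth \<zeta> y' Z_ob in \<open>simp_all add: q_def\<close>)
    qed (use z_src z_nth y' Z_ob in \<open>simp_all add: q_def\<close>)
    moreover have "is_biproduct C (src C (x ! k)) (src C (z ! k)) (src C (y ! k)) (f k) (j k) (g k) (q k)"
      if k: "k \<le> Suc n" for k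
    proof -
      have "hzero C Z Z = ide C Z"
        by (rule zero_object_initial[OF Z]) (use Z_ob in simp_all)
      then show ?thesis
        using fk[OF k] z_src[OF k] y'(1)[OF k] Z_ob
        by (simp add: is_biproduct_def Hom_def j_def q_def)
    qed
    ultimately show ?thesis
      unfolding seq_direct_sum_def using f g by (metis Suc_eq_plus1)
  qed
  ultimately show "y \<in> \<T>" using F1a_sum[OF x _ y] by blast
qed

end


section \<open>Sequences in a skeleton\<close>

locale skeleton_of_angulated =
  weak_pre_angulated_category n C \<Sigma> \<T> + skeleton_autoequivalence C S \<Sigma> \<Gamma>
  for n :: nat and C :: "('o, 'm, 'z) add_cat_data_scheme" (structure) and \<Sigma> \<T> S \<Gamma>
begin

abbreviation seq\<^sub>S :: "'m list \<Rightarrow> bool" where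
  "seq\<^sub>S \<equiv> sigma_sequence n B \<Sigma>\<^sub>S"

abbreviation \<theta> :: "'o \<Rightarrow> 'm" where
  "\<theta> X \<equiv> from_rep (fob \<Sigma> X)"

text \<open>Composing the last arrow with the isomorphism from \<open>\<Sigma>\<^sub>S X\<^sup>0\<close> to \<open>\<Sigma> X\<^sup>0\<close> turns a
  \<open>\<Sigma>\<^sub>S\<close>-sequence into a \<open>\<Sigma>\<close>-sequence.\<close>

definition \<Phi> :: "'m list \<Rightarrow> 'm list" where
  "\<Phi> x = x[Suc n := \<theta> (src C (x ! 0)) \<cdot> x ! Suc n]"

definition \<T>\<^sub>S :: "'m list set" where
  "\<T>\<^sub>S = {x. seq\<^sub>S x \<and> \<Phi> x \<in> \<T>}"

sublocale B: additive_category B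
  by (rule additive_skeleton) (rule category_skeleton_axioms)

text \<open>No condition that targets lie in \<open>S\<close> is listed: each target is the next
  source or, at the end, a representative.\<close>

lemma seq\<^sub>S_iff:
  "seq\<^sub>S x \<longleftrightarrow> length x = n + 2 \<and> (\<forall>k \<le> Suc n. x ! k \<in> arr C \<and> src C (x ! k) \<in> S) \<and>
    (\<forall>k \<le> n. tgt C (x ! k) = src C (x ! Suc k)) \<and> tgt C (x ! Suc n) = rep (fob \<Sigma> (src C (x ! 0)))"
proof -
  have "tgt C (x ! k) \<in> S" if "\<forall>k \<le> Suc n. x ! k \<in> arr C \<and> src C (x ! k) \<in> S"
    "\<forall>k \<le> n. tgt C (x ! k) = src C (x ! Suc k)" "tgt C (x ! Suc n) = rep (fob \<Sigma> (src C (x ! 0)))"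
    "k \<le> Suc n" for k
    using that by (cases "k = Suc n") auto
  then show ?thesis unfolding B.sigma_sequence_iff by auto
qed

lemma \<Phi>_nth:
  assumes "seq\<^sub>S x"
  shows "k \<le> n \<Longrightarrow> \<Phi> x ! k = x ! k" "\<Phi> x ! Suc n = \<theta> (src C (x ! 0)) \<cdot> x ! Suc n"
  using assms by (simp_all add: seq\<^sub>S_iff \<Phi>_def)

lemma src_\<Phi>: "\<lbrakk>seq\<^sub>S x; k \<le> Suc n\<rbrakk> \<Longrightarrow> src C (\<Phi> x ! k) = src C (x ! k)"
  by (cases "k = Suc n") (auto simp: \<Phi>_nth seq\<^sub>S_iff)

lemma sigma_sequence_\<Phi>:
  assumes "seq\<^sub>S x"
  shows "sigma_sequence n C \<Sigma> (\<Phi> x)"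
proof -
  have "\<Phi> x ! k \<in> arr C" if "k \<le> Suc n" for k
    using assms that by (cases "k = Suc n") (auto simp: \<Phi>_nth seq\<^sub>S_iff)
  moreover have "tgt C (\<Phi> x ! Suc n) = fob \<Sigma> (src C (x ! 0))" "length (\<Phi> x) = n + 2"
    using assms by (auto simp: \<Phi>_nth seq\<^sub>S_iff) (simp add: \<Phi>_def)
  ultimately show ?thesis
    using assms by (auto simp: sigma_sequence_iff src_\<Phi> \<Phi>_nth(1)) (auto simp: seq\<^sub>S_iff)
qed

text \<open>Only the last square differs. By naturality its two sides in \<open>C\<close> are the
  two sides in \<open>B\<close> followed by the isomorphism \<theta> at Y^0, which can be
  cancelled.\<close>

lemma seq_morphism_\<Phi>:
  assumes x: "seq\<^sub>S x" and y: "seq\<^sub>S y"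
  shows "seq_morphism n C \<Sigma> (\<Phi> x) (\<Phi> y) f \<longleftrightarrow> seq_morphism n B \<Sigma>\<^sub>S x y f"
proof -
  have x': "\<And>k. k \<le> Suc n \<Longrightarrow> x ! k \<in> arr C \<and> src C (x ! k) \<in> S"
    "tgt C (x ! Suc n) = rep (fob \<Sigma> (src C (x ! 0)))"
    and y': "\<And>k. k \<le> Suc n \<Longrightarrow> y ! k \<in> arr C \<and> src C (y ! k) \<in> S"
    "tgt C (y ! Suc n) = rep (fob \<Sigma> (src C (y ! 0)))"
    using x y by (auto simp: seq\<^sub>S_iff)
  have last: "farr \<Sigma> (f 0) \<cdot> \<Phi> x ! Suc n = \<Phi> y ! Suc n \<cdot> f (Suc n) \<longleftrightarrow>
      farr \<Sigma>\<^sub>S (f 0) \<cdot> x ! Suc n = y ! Suc n \<cdot> f (Suc n)" (is "?l1 = ?r1 \<longleftrightarrow> ?l2 = ?r2")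
    if f: "\<forall>k \<le> Suc n. f k \<in> arr C \<and> src C (f k) = src C (x ! k) \<and> tgt C (f k) = src C (y ! k)"
  proof -
    let ?Y = "fob \<Sigma> (src C (y ! 0))"
    have Y: "?Y \<in> ob C" using y'(1)[of 0] by simp
    have l: "?l1 = from_rep ?Y \<cdot> ?l2"
      using f x' y'(1)[of 0] from_rep_natural[of "f 0" "src C (y ! 0)"]
      by (simp add: \<Phi>_nth[OF x] assoc[symmetric])
    have r: "?r1 = from_rep ?Y \<cdot> ?r2"
      using f y' by (simp add: \<Phi>_nth[OF y] assoc)
    have "?l2 \<in> arr C" "tgt C ?l2 = rep ?Y" "?r2 \<in> arr C" "tgt C ?r2 = rep ?Y"
      using f x' y' by simp_all
    then show ?thesis unfolding l r using cmp_rep(4)[OF Y] by metis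
  qed
  show ?thesis
    unfolding seq_morphism_iff B.seq_morphism_iff
    using last x' y' by (auto simp: src_\<Phi> x y \<Phi>_nth(1))
qed

text \<open>\<open>\<Phi>\<close> preserves all sources, hence all objects, and the morphisms
  between sequences are the same tuples, so the data of a biproduct of sequences are the same on
  both sides.\<close>

lemma seq_direct_sum_\<Phi>:
  assumes "seq\<^sub>S x" "seq\<^sub>S y" "seq\<^sub>S z"
  shows "seq_direct_sum n C \<Sigma> (\<Phi> x) (\<Phi> y) (\<Phi> z) \<longleftrightarrow> seq_direct_sum n B \<Sigma>\<^sub>S x y z"
proof -
  have "is_biproduct B (src C (x ! k)) (src C (y ! k)) (src C (z ! k)) i j p q \<longleftrightarrow>
    is_biproduct C (src C (x ! k)) (src C (y ! k)) (src C (z ! k)) i j p q"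
    if "k \<le> n + 1" for k i j p q
    by (rule is_biproduct_full_subcategory) (use that assms in \<open>simp_all add: seq\<^sub>S_iff\<close>)
  then show ?thesis
    unfolding seq_direct_sum_def using assms by (simp add: seq_morphism_\<Phi> src_\<Phi> cong: conj_cong)
qed

lemma \<T>\<^sub>S_iso_closed:
  assumes "x \<in> \<T>" "seq\<^sub>S y" "seq_morphism n C \<Sigma> x (\<Phi> y) f" "\<And>k. k \<le> Suc n \<Longrightarrow> inverses (f k) (g k)"
  shows "y \<in> \<T>\<^sub>S"
  using iso_closed[OF assms(1) sigma_sequence_\<Phi>[OF assms(2)] assms(3,4)] assms(2)
  by (simp add: \<T>\<^sub>S_def)

text \<open>The sequence that (F1c) provides in \<open>C\<close> is conjugated, arrow by arrow, into
  the skeleton. The first arrow survives because both its ends lie in \<open>S\<close>, where the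
  chosen isomorphisms are identities.\<close>

lemma \<T>\<^sub>S_F1c:
  assumes h: "h \<in> arr B"
  shows "\<exists>y \<in> \<T>\<^sub>S. y ! 0 = h"
proof -
  obtain x where x: "x \<in> \<T>" "x ! 0 = h" using F1c[of h] h by auto
  have x': "\<And>k. k \<le> Suc n \<Longrightarrow> x ! k \<in> arr C" "\<And>k. k \<le> n \<Longrightarrow> tgt C (x ! k) = src C (x ! Suc k)"
    "tgt C (x ! Suc n) = fob \<Sigma> (src C (x ! 0))"
    using sequences[OF x(1)] by (auto simp: sigma_sequence_iff)
  let ?X = "\<lambda>k. src C (x ! k)"
  have X: "?X k \<in> ob C" "fob \<Sigma> (?X k) \<in> ob C" if "k \<le> Suc n" for k using x'(1)[OF that] by simp_all
  have X0: "?X 0 \<in> S" using x h by simp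
  define y where "y = map (\<lambda>k. to_rep (tgt C (x ! k)) \<cdot> (x ! k \<cdot> from_rep (?X k))) [0..<n + 2]"
  have y_nth: "y ! k = to_rep (tgt C (x ! k)) \<cdot> (x ! k \<cdot> from_rep (?X k))" if "k \<le> Suc n" for k
    unfolding y_def by (subst nth_map_upt) (use that in simp_all)
  have y_arr: "y ! k \<in> arr C \<and> src C (y ! k) = rep (?X k) \<and> tgt C (y ! k) = rep (tgt C (x ! k))"
    if "k \<le> Suc n" for k
    using x'(1)[OF that] by (simp add: y_nth[OF that])
  have seq_y: "seq\<^sub>S y"
    using y_arr x' X0 X by (auto simp: seq\<^sub>S_iff y_def rep_eq)
  have "seq_morphism n C \<Sigma> x (\<Phi> y) (\<lambda>k. to_rep (?X k))"
  proof -
    have "to_rep (?X (Suc k)) \<cdot> x ! k = \<Phi> y ! k \<cdot> to_rep (?X k)" if k: "k \<le> n" for k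
      using x'(1)[of k] x'(2)[OF k] k X[of k] X[of "Suc k"]
      by (simp add: \<Phi>_nth(1)[OF seq_y k] y_nth assoc)
    \<comment> \<open>The last arrow of \<open>y\<close> carries an extra \<open>to_rep\<close> at
      \<Sigma> X^0, which is cancelled by the isomorphism that \<open>\<Phi>\<close> adds.\<close>
    moreover have "farr \<Sigma> (to_rep (?X 0)) \<cdot> x ! Suc n = \<Phi> y ! Suc n \<cdot> to_rep (?X (Suc n))"
      using x'(1)[of "Suc n"] x'(3) X0 X[of 0] X[of "Suc n"] y_arr[of 0]
      by (simp add: \<Phi>_nth(2)[OF seq_y] y_nth assoc to_rep_eq rep_eq)
    ultimately show ?thesis
      using X y_arr by (simp add: seq_morphism_iff src_\<Phi>[OF seq_y])
  qed
  then have "y \<in> \<T>\<^sub>S"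
    by (rule \<T>\<^sub>S_iso_closed[OF x(1) seq_y]) (rule inverses_rep, rule X)
  moreover have "y ! 0 = h"
    using h x(2) by (simp add: y_nth to_rep_eq from_rep_eq)
  ultimately show ?thesis by blast
qed

section \<open>Rotation in the skeleton\<close>

lemma rotation_nth:
  assumes "length x = n + 2"
  shows "k \<le> n \<Longrightarrow> rotation n A F x ! k = x ! Suc k"
    "rotation n A F x ! Suc n = (if even n then farr F (x ! 0) else hneg A (farr F (x ! 0)))"
    "length (rotation n A F x) = n + 2"
  using assms by (auto simp: rotation_def nth_append nth_tl)

lemma sigma_sequence_rotation:
  assumes "sigma_sequence n C \<Sigma> x"
  shows "sigma_sequence n C \<Sigma> (rotation n C \<Sigma> x)"
proof -
  have x: "length x = n + 2" "\<And>k. k \<le> Suc n \<Longrightarrow> x ! k \<in> arr C"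
    "\<And>k. k \<le> n \<Longrightarrow> tgt C (x ! k) = src C (x ! Suc k)"
    "tgt C (x ! Suc n) = fob \<Sigma> (src C (x ! 0))"
    using assms by (auto simp: sigma_sequence_iff)
  let ?r = "rotation n C \<Sigma> x"
  have last: "?r ! Suc n \<in> arr C" "src C (?r ! Suc n) = fob \<Sigma> (src C (x ! 0))"
    "tgt C (?r ! Suc n) = fob \<Sigma> (src C (x ! Suc 0))"
    using x(2)[of 0] x(3)[of 0] by (auto simp: rotation_nth(2)[OF x(1)])
  have "?r ! k \<in> arr C" if "k \<le> Suc n" for k
    using that last x(2)[of "Suc k"] by (cases "k = Suc n") (auto simp: rotation_nth(1)[OF x(1)])
  moreover have "tgt C (?r ! k) = src C (?r ! Suc k)" if "k \<le> n" for k
    using that last x(3)[of "Suc k"] x(4)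
    by (cases "k = n") (auto simp: rotation_nth(1)[OF x(1)])
  ultimately show ?thesis
    using last x(1) by (auto simp: sigma_sequence_iff rotation_nth)
qed

lemma seq\<^sub>S_rotation:
  assumes "seq\<^sub>S x"
  shows "seq\<^sub>S (rotation n B \<Sigma>\<^sub>S x)"
proof -
  have x: "length x = n + 2" "\<And>k. k \<le> Suc n \<Longrightarrow> x ! k \<in> arr C \<and> src C (x ! k) \<in> S"
    "\<And>k. k \<le> n \<Longrightarrow> tgt C (x ! k) = src C (x ! Suc k)"
    "tgt C (x ! Suc n) = rep (fob \<Sigma> (src C (x ! 0)))"
    using assms by (auto simp: seq\<^sub>S_iff)
  let ?r = "rotation n B \<Sigma>\<^sub>S x"
  have last: "?r ! Suc n \<in> arr C" "src C (?r ! Suc n) = rep (fob \<Sigma> (src C (x ! 0)))"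
    "tgt C (?r ! Suc n) = rep (fob \<Sigma> (src C (x ! Suc 0)))"
    using x(2)[of 0] x(2)[of "Suc 0"] x(3)[of 0]
    by (auto simp: rotation_nth(2)[OF x(1)] hneg_full_subcategory)
  have "?r ! k \<in> arr C \<and> src C (?r ! k) \<in> S" if "k \<le> Suc n" for k
    using that last x(2)[of "Suc k"] x(2)[of 0]
    by (cases "k = Suc n") (auto simp: rotation_nth(1)[OF x(1)])
  moreover have "tgt C (?r ! k) = src C (?r ! Suc k)" if "k \<le> n" for k
    using that last x(3)[of "Suc k"] x(4)
    by (cases "k = n") (auto simp: rotation_nth(1)[OF x(1)])
  ultimately show ?thesis
    using last x(1) by (auto simp: seq\<^sub>S_iff rotation_nth)
qed

text \<open>\<open>\<Phi>\<close> of the rotation and the rotation of \<open>\<Phi> x\<close> have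
  the same objects except the last one, which is \<open>\<Sigma>\<^sub>S\<close> X^0 in the former
  and \<Sigma> X^0 in the latter. They are isomorphic, so (F2) in \<open>C\<close> applies through
  closure under isomorphism.\<close>

lemma \<T>\<^sub>S_F2:
  assumes x: "seq\<^sub>S x"
  shows "x \<in> \<T>\<^sub>S \<longleftrightarrow> rotation n B \<Sigma>\<^sub>S x \<in> \<T>\<^sub>S"
proof -
  let ?r = "rotation n C \<Sigma> (\<Phi> x)" and ?s = "rotation n B \<Sigma>\<^sub>S x"
  have x': "length x = n + 2" "\<And>k. k \<le> Suc n \<Longrightarrow> x ! k \<in> arr C \<and> src C (x ! k) \<in> S"
    "\<And>k. k \<le> n \<Longrightarrow> tgt C (x ! k) = src C (x ! Suc k)"
    "tgt C (x ! Suc n) = rep (fob \<Sigma> (src C (x ! 0)))"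
    using x by (auto simp: seq\<^sub>S_iff)
  have len: "length (\<Phi> x) = n + 2" using x' by (simp add: \<Phi>_def)
  have seq_r: "sigma_sequence n C \<Sigma> ?r" by (rule sigma_sequence_rotation[OF sigma_sequence_\<Phi>[OF x]])
  have seq_s: "seq\<^sub>S ?s" by (rule seq\<^sub>S_rotation[OF x])
  note seq_\<Phi>s = sigma_sequence_\<Phi>[OF seq_s]
  let ?X = "\<lambda>k. src C (x ! k)"
  \<comment> \<open>Places 0, ..., n carry X^1, ..., X^{n+1} in both sequences, whence identities
    there; only place n + 1 needs \<theta>.\<close>
  define f where "f k = (if k = Suc n then \<theta> (?X 0) else ide C (?X (Suc k)))" for k
  define g where "g k = (if k = Suc n then to_rep (fob \<Sigma> (?X 0)) else ide C (?X (Suc k)))" for k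
  have inv: "inverses (f k) (g k)" if "k \<le> Suc n" for k
    using that x'(2)[of 0] x'(2)[of "Suc k"] inverses_sym[OF inverses_rep] inverses_ide
    by (auto simp: f_def g_def)
  have r_nth: "?r ! k = x ! Suc k" if "k < n" for k
    using that by (simp add: rotation_nth(1)[OF len] \<Phi>_nth[OF x])
  have r_n: "?r ! n = \<theta> (?X 0) \<cdot> x ! Suc n"
    by (simp add: rotation_nth(1)[OF len] \<Phi>_nth[OF x])
  have s_nth: "\<Phi> ?s ! k = x ! Suc k" if "k \<le> n" for k
    using that by (simp add: rotation_nth(1)[OF x'(1)] \<Phi>_nth[OF seq_s])
  have src_r: "src C (?r ! Suc n) = fob \<Sigma> (?X 0)"
    using x'(2)[of 0] \<Phi>_nth(1)[OF x, of 0] by (simp add: rotation_nth(2)[OF len])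
  have src_s: "src C (\<Phi> ?s ! Suc n) = rep (fob \<Sigma> (?X 0))"
    using x'(2)[of 0] x'(2)[of "Suc 0"] x'(3)[of 0]
    by (simp add: src_\<Phi>[OF seq_s] rotation_nth(2)[OF x'(1)] hneg_full_subcategory)
  \<comment> \<open>This is naturality of \<theta> for the first arrow of \<open>x\<close>; for odd
    \<open>n\<close> the sign passes through composition on both sides.\<close>
  have last: "\<Phi> ?s ! Suc n = ?r ! Suc n \<cdot> \<theta> (?X 0)"
    using x'(2)[of 0] x'(2)[of "Suc 0"] x'(3)[of 0] n_ge_1 \<Phi>_nth(1)[OF x, of 0]
      from_rep_natural[of "x ! 0" "src C (x ! Suc 0)"]
    by (simp add: \<Phi>_nth(2)[OF seq_s] rotation_nth[OF x'(1)] rotation_nth(2)[OF len]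
      hneg_full_subcategory cmp_hneg hneg_cmp)
  have f: "seq_morphism n C \<Sigma> (\<Phi> ?s) ?r f"
  proof -
    have "f k \<in> arr C \<and> src C (f k) = src C (\<Phi> ?s ! k) \<and> tgt C (f k) = src C (?r ! k)"
      if k: "k \<le> Suc n" for k
    proof -
      consider "k < n" | "k = n" | "k = Suc n" using k by linarith
      then show ?thesis
        by cases (use x'(2)[of 0] x'(2)[of "Suc k"] x'(4) in
          \<open>simp_all add: f_def r_nth r_n s_nth src_r src_s\<close>)
    qed
    moreover have "f (Suc k) \<cdot> \<Phi> ?s ! k = ?r ! k \<cdot> f k" if "k \<le> n" for k
    proof (cases "k = n")
      case True
      then show ?thesis using x'(2)[of 0] x'(2)[of "Suc n"] x'(4) by (simp add: f_def r_n s_nth)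
    next
      case False
      then show ?thesis using that x'(2)[of "Suc k"] x'(3)[of "Suc k"] by (simp add: f_def r_nth s_nth)
    qed
    moreover have "farr \<Sigma> (f 0) \<cdot> \<Phi> ?s ! Suc n = ?r ! Suc n \<cdot> f (Suc n)"
    proof -
      have "\<Phi> ?s ! Suc n \<in> arr C" "tgt C (\<Phi> ?s ! Suc n) = fob \<Sigma> (?X (Suc 0))"
        using seq_\<Phi>s s_nth[of 0] by (simp_all add: sigma_sequence_iff)
      then have "farr \<Sigma> (f 0) \<cdot> \<Phi> ?s ! Suc n = \<Phi> ?s ! Suc n"
        using x'(2)[of "Suc 0"] n_ge_1 by (simp add: f_def)
      also have "\<dots> = ?r ! Suc n \<cdot> f (Suc n)" using last by (simp add: f_def)
      finally show ?thesis .
    qed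
    ultimately show ?thesis by (simp add: seq_morphism_iff)
  qed
  have g: "seq_morphism n C \<Sigma> ?r (\<Phi> ?s) g" by (rule seq_morphism_inverses[OF seq_\<Phi>s seq_r f inv])
  have "\<Phi> ?s \<in> \<T> \<longleftrightarrow> ?r \<in> \<T>"
    using iso_closed[OF _ seq_r f inv] iso_closed[OF _ seq_\<Phi>s g inverses_sym[OF inv]] by blast
  also have "\<dots> \<longleftrightarrow> \<Phi> x \<in> \<T>" using F2[OF sigma_sequence_\<Phi>[OF x]] by simp
  finally show ?thesis using x seq_s by (simp add: \<T>\<^sub>S_def)
qed

text \<open>The input of (F3) and (F4) involves only the first arrow and the first two objects of
  each sequence, all fixed by \<open>\<Phi>\<close>.\<close>

lemma \<T>\<^sub>S_F3_square:
  assumes x: "seq\<^sub>S x" and y: "seq\<^sub>S y"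
    and f: "f0 \<in> Hom B (src B (x ! 0)) (src B (y ! 0))" "f1 \<in> Hom B (src B (x ! 1)) (src B (y ! 1))"
      "f1 \<cdot>\<^bsub>B\<^esub> x ! 0 = y ! 0 \<cdot>\<^bsub>B\<^esub> f0"
  shows "f0 \<in> Hom C (src C (\<Phi> x ! 0)) (src C (\<Phi> y ! 0))"
    "f1 \<in> Hom C (src C (\<Phi> x ! 1)) (src C (\<Phi> y ! 1))" "f1 \<cdot> \<Phi> x ! 0 = \<Phi> y ! 0 \<cdot> f0"
  using f src_\<Phi>[OF x] src_\<Phi>[OF y] by (simp_all add: Hom_def \<Phi>_nth(1) x y)

lemma strong_pre_angulated_skeleton: "strong_pre_angulated_category n B \<Sigma>\<^sub>S \<T>\<^sub>S"
proof (intro strong_pre_angulated_category.intro strong_pre_angulated_category_axioms.intro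
    weak_pre_angulated_category.intro B.additive_category_axioms weak_pre_angulated_category_axioms.intro)
  show "automorphism B \<Sigma>\<^sub>S" by (rule automorphism_\<Sigma>\<^sub>S)
  then show "autoequivalence B \<Sigma>\<^sub>S" by (rule B.autoequivalence_if_automorphism)
  show "n \<ge> 1" by (rule n_ge_1)
  show "seq\<^sub>S x" if "x \<in> \<T>\<^sub>S" for x using that by (simp add: \<T>\<^sub>S_def)
  show "z \<in> \<T>\<^sub>S" if z: "seq\<^sub>S z" and "\<forall>k \<le> n + 1. zero_object B (src B (z ! k))" for z
  proof -
    have "\<forall>k \<le> n + 1. zero_object C (src C (\<Phi> z ! k))"
      using that zero_object_B by (auto simp: src_\<Phi> seq\<^sub>S_iff)
    then show ?thesis using F1a_zero[OF sigma_sequence_\<Phi>[OF z]] z by (simp add: \<T>\<^sub>S_def)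
  qed
  show "z \<in> \<T>\<^sub>S" if "x \<in> \<T>\<^sub>S" "y \<in> \<T>\<^sub>S" "seq\<^sub>S z" "seq_direct_sum n B \<Sigma>\<^sub>S x y z" for x y z
    using that F1a_sum[of "\<Phi> x" "\<Phi> y" "\<Phi> z"] sigma_sequence_\<Phi> seq_direct_sum_\<Phi>
    by (simp add: \<T>\<^sub>S_def)
  show "x \<in> \<T>\<^sub>S" if "z \<in> \<T>\<^sub>S" "seq\<^sub>S x" "seq\<^sub>S y" "seq_direct_sum n B \<Sigma>\<^sub>S x y z" for x y z
    using that F1a_summand[of "\<Phi> z" "\<Phi> x" "\<Phi> y"] sigma_sequence_\<Phi> seq_direct_sum_\<Phi>
    by (simp add: \<T>\<^sub>S_def)
  show "x \<in> \<T>\<^sub>S" if X: "X \<in> ob B" and x: "seq\<^sub>S x" and x0: "x ! 0 = ide B X"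
    and zero: "\<forall>k \<in> {2..n + 1}. zero_object B (src B (x ! k))" for X x
  proof -
    have "\<forall>k \<in> {2..n + 1}. zero_object C (src C (\<Phi> x ! k))"
      using x zero zero_object_B by (auto simp: src_\<Phi> seq\<^sub>S_iff)
    then show ?thesis
      using F1b[OF _ sigma_sequence_\<Phi>[OF x], of X] x x0 X \<Phi>_nth(1)[OF x, of 0] by (simp add: \<T>\<^sub>S_def)
  qed
  show "\<exists>x \<in> \<T>\<^sub>S. x ! 0 = f" if "f \<in> arr B" for f by (rule \<T>\<^sub>S_F1c[OF that])
  show "x \<in> \<T>\<^sub>S \<longleftrightarrow> rotation n B \<Sigma>\<^sub>S x \<in> \<T>\<^sub>S" if "seq\<^sub>S x" for x by (rule \<T>\<^sub>S_F2[OF that])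
  show "\<exists>f. f 0 = f0 \<and> f 1 = f1 \<and> seq_morphism n B \<Sigma>\<^sub>S x y f"
    if "x \<in> \<T>\<^sub>S" "y \<in> \<T>\<^sub>S" and f: "f0 \<in> Hom B (src B (x ! 0)) (src B (y ! 0))"
      "f1 \<in> Hom B (src B (x ! 1)) (src B (y ! 1))" "f1 \<cdot>\<^bsub>B\<^esub> x ! 0 = y ! 0 \<cdot>\<^bsub>B\<^esub> f0"
    for x y f0 f1
  proof -
    have x: "seq\<^sub>S x" "\<Phi> x \<in> \<T>" and y: "seq\<^sub>S y" "\<Phi> y \<in> \<T>" using that by (simp_all add: \<T>\<^sub>S_def)
    show ?thesis
      using F3[OF x(2) y(2) \<T>\<^sub>S_F3_square[OF x(1) y(1) f]] unfolding seq_morphism_\<Phi>[OF x(1) y(1)] .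
  qed
qed

section \<open>Cones in the skeleton\<close>

lemma from_rep_natural_assoc:
  assumes "f \<in> arr C" "h \<in> arr C" "tgt C h = rep (fob \<Sigma> (src C f))"
  shows "\<theta> (tgt C f) \<cdot> (farr \<Sigma>\<^sub>S f \<cdot> h) = farr \<Sigma> f \<cdot> (\<theta> (src C f) \<cdot> h)"
  using assms assoc[of h "farr \<Sigma>\<^sub>S f" "\<theta> (tgt C f)"] from_rep_natural[OF assms(1) refl]
  by (simp add: assoc)

text \<open>The biproducts chosen in \<open>B\<close> are also biproducts in \<open>C\<close>, and
  only the last one has to be adapted. In the formula for the differentials the adaptation cancels
  at place n, and at place n + 1 naturality of \<theta> replaces \<open>\<Sigma>\<^sub>S\<close> by
  \<Sigma>.\<close>

lemma is_cone_\<Phi>: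
  assumes x: "seq\<^sub>S x" and y: "seq\<^sub>S y" and f: "seq_morphism n B \<Sigma>\<^sub>S x y f"
    and cone: "is_cone n B \<Sigma>\<^sub>S x y f c"
  shows "is_cone n C \<Sigma> (\<Phi> x) (\<Phi> y) f (\<Phi> c)"
proof -
  let ?dB = "x @ [farr \<Sigma>\<^sub>S (x ! 0)]" and ?dC = "\<Phi> x @ [farr \<Sigma> (\<Phi> x ! 0)]"
  let ?fB = "f(n + 2 := farr \<Sigma>\<^sub>S (f 0))" and ?fC = "f(n + 2 := farr \<Sigma> (f 0))"
  have c: "seq\<^sub>S c" using cone by (simp add: is_cone_def)
  obtain i j p q where
    bip: "\<forall>k \<le> n + 1. is_biproduct B (src B (?dB ! (k + 1))) (src B (y ! k)) (src B (c ! k))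
          (i k) (j k) (p k) (q k)"
    and ij: "i (n + 2) = farr \<Sigma>\<^sub>S (i 0)" "j (n + 2) = farr \<Sigma>\<^sub>S (j 0)"
    and eq: "\<forall>k \<le> n + 1. c ! k =
          i (k + 1) \<cdot> hneg B (?dB ! (k + 1)) \<cdot> p k \<boxplus> j (k + 1) \<cdot> ?fB (k + 1) \<cdot> p k \<boxplus>
          j (k + 1) \<cdot> y ! k \<cdot> q k"
    using cone unfolding is_cone_def Let_def by auto
  have x': "length x = n + 2" "\<And>k. k \<le> Suc n \<Longrightarrow> x ! k \<in> arr C \<and> src C (x ! k) \<in> S"
    "\<And>k. k \<le> n \<Longrightarrow> tgt C (x ! k) = src C (x ! Suc k)"
    "tgt C (x ! Suc n) = rep (fob \<Sigma> (src C (x ! 0)))"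
    using x by (auto simp: seq\<^sub>S_iff)
  have y': "\<And>k. k \<le> Suc n \<Longrightarrow> y ! k \<in> arr C \<and> src C (y ! k) \<in> S"
    "\<And>k. k \<le> n \<Longrightarrow> tgt C (y ! k) = src C (y ! Suc k)"
    "tgt C (y ! Suc n) = rep (fob \<Sigma> (src C (y ! 0)))"
    using y by (auto simp: seq\<^sub>S_iff)
  have c': "src C (c ! k) \<in> S" if "k \<le> Suc n" for k
    using c that by (auto simp: seq\<^sub>S_iff)
  have f': "f k \<in> arr C" "src C (f k) = src C (x ! k)" "tgt C (f k) = src C (y ! k)" if "k \<le> Suc n" for k
    using f that by (auto simp: B.seq_morphism_iff)
  have len: "length (\<Phi> x) = n + 2" using x' by (simp add: \<Phi>_def)
  have d: "k \<le> n \<Longrightarrow> (x @ [g]) ! Suc k = x ! Suc k" "(x @ [g]) ! Suc (Suc n) = g"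
    "k \<le> n \<Longrightarrow> (\<Phi> x @ [g]) ! Suc k = \<Phi> x ! Suc k" "(\<Phi> x @ [g]) ! Suc (Suc n) = g" for k g
    using x'(1) len by (simp_all add: nth_append)
  let ?X = "\<lambda>k. src C (x ! k)" and ?Y = "\<lambda>k. src C (y ! k)" and ?C = "\<lambda>k. src C (c ! k)"
  have X0: "fob \<Sigma> (?X 0) \<in> ob C" using x'(2)[of 0] by simp
  have bip_le: "is_biproduct C (?X (Suc k)) (?Y k) (?C k) (i k) (j k) (p k) (q k)" if k: "k \<le> n" for k
    using bip[rule_format, of k] k d(1)[OF k] x'(2)[of "Suc k"] y'(1)[of k] c'[of k]
    by (simp add: is_biproduct_full_subcategory)
  have bip_last: "is_biproduct C (rep (fob \<Sigma> (?X 0))) (?Y (Suc n)) (?C (Suc n))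
    (i (Suc n)) (j (Suc n)) (p (Suc n)) (q (Suc n))"
    using bip[rule_format, of "Suc n"] d(2) x'(2)[of 0] y'(1)[of "Suc n"] c'[of "Suc n"] X0
    by (simp add: is_biproduct_full_subcategory)
  \<comment> \<open>At n + 1 the left summand changes from \<open>\<Sigma>\<^sub>S\<close> X^0 to
    \<Sigma> X^0, so injection and projection absorb the chosen isomorphism. The values at n + 2 are
    those that \<open>is_cone\<close> prescribes, with \<Sigma> in place of
    \<open>\<Sigma>\<^sub>S\<close>.\<close>
  define i' where "i' = i(Suc n := i (Suc n) \<cdot> to_rep (fob \<Sigma> (?X 0)), n + 2 := farr \<Sigma> (i 0))"
  define j' where "j' = j(n + 2 := farr \<Sigma> (j 0))"
  define p' where "p' = p(Suc n := \<theta> (?X 0) \<cdot> p (Suc n))"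
  have arrs: "i k \<in> arr C" "j k \<in> arr C" "p k \<in> arr C" "q k \<in> arr C"
    "tgt C (i k) = ?C k" "tgt C (j k) = ?C k" "src C (j k) = ?Y k" "src C (p k) = ?C k"
    "src C (q k) = ?C k" "tgt C (q k) = ?Y k" if "k \<le> Suc n" for k
    using bip_le[of k] bip_last that by (cases "k = Suc n"; simp add: is_biproduct_def Hom_def)+
  have src_i: "src C (i k) = ?X (Suc k)" "tgt C (p k) = ?X (Suc k)" if "k \<le> n" for k
    using bip_le[OF that] by (simp_all add: is_biproduct_def Hom_def)
  have src_i_last: "src C (i (Suc n)) = rep (fob \<Sigma> (?X 0))" "tgt C (p (Suc n)) = rep (fob \<Sigma> (?X 0))"
    using bip_last by (simp_all add: is_biproduct_def Hom_def)
  have bip': "is_biproduct C (src C (?dC ! (k + 1))) (src C (\<Phi> y ! k)) (src C (\<Phi> c ! k))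
      (i' k) (j' k) (p' k) (q k)" if k: "k \<le> n + 1" for k
  proof (cases "k = Suc n")
    case True
    then show ?thesis
      using is_biproduct_iso_left[OF bip_last inverses_rep[OF X0]] X0 x'(2)[of 0]
      by (simp add: src_\<Phi>[OF y] src_\<Phi>[OF c] \<Phi>_nth(1)[OF x, of 0] d(4) i'_def j'_def p'_def)
  next
    case False
    then show ?thesis
      using bip_le[of k] k
      by (simp add: src_\<Phi>[OF x] src_\<Phi>[OF y] src_\<Phi>[OF c] d(3) i'_def j'_def p'_def)
  qed
  have eq': "\<Phi> c ! k = i' (k + 1) \<cdot> hneg C (?dC ! (k + 1)) \<cdot> p' k \<boxplus>
      j' (k + 1) \<cdot> ?fC (k + 1) \<cdot> p' k \<boxplus> j' (k + 1) \<cdot> \<Phi> y ! k \<cdot> q k" if k: "k \<le> n + 1" for k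
  proof -
    consider "k < n" | "k = n" | "k = Suc n" using k by linarith
    then show ?thesis
    proof cases
      case 1
      then show ?thesis
        using eq[rule_format, of k] x'(2)[of "Suc k"] x'(2)[of "Suc (Suc k)"] x'(3)[of "Suc k"]
        by (simp add: \<Phi>_nth(1) x y c d i'_def j'_def p'_def hneg_full_subcategory)
    next
      case 2
      \<comment> \<open>The isomorphism that \<open>\<Phi>\<close> adds to the last arrow of
        \<open>x\<close> meets its inverse inside \<open>i' (Suc n)\<close>.\<close>
      have "i (Suc n) \<cdot> to_rep (fob \<Sigma> (?X 0)) \<cdot> hneg C (\<theta> (?X 0) \<cdot> x ! Suc n) \<cdot> p n =
        i (Suc n) \<cdot> hneg C (x ! Suc n) \<cdot> p n"
        using X0 x'(2)[of "Suc n"] x'(4) arrs[of n] arrs[of "Suc n"] src_i[of n] src_i_last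
        by (simp add: cmp_hneg[symmetric] assoc)
      then show ?thesis
        using 2 eq[rule_format, of n] x'(2)[of "Suc n"] x'(2)[of 0] x'(4) X0
        by (simp add: \<Phi>_nth x y c d i'_def j'_def p'_def hneg_full_subcategory)
    next
      case 3
      let ?P = "p (Suc n)" and ?Q = "q (Suc n)"
      \<comment> \<open>To move \<theta> past an image under \<open>\<Sigma>\<^sub>S\<close>, its
        index must be displayed as a target: that of \<open>i 0\<close> for the first summand of the
        differential, that of \<open>j 0\<close> for the other two.\<close>
      have C0: "\<theta> (?C 0) = \<theta> (tgt C (i 0))" "\<theta> (?C 0) = \<theta> (tgt C (j 0))" using arrs[of 0] by simp_all
      note arrs0 = arrs[of 0] arrs[of "Suc n"] src_i[of 0] src_i_last
        x'(2)[of 0] x'(2)[of "Suc 0"] x'(3)[of 0] x'(4) y'(1)[of 0] y'(1)[of "Suc n"] y'(3) f'[of 0] X0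
      note natural = from_rep_natural_assoc
      \<comment> \<open>Naturality speaks of the image of an arrow, not of its negative, so the sign
        is pulled out first and put back afterwards.\<close>
      have neg: "\<theta> (?X (Suc 0)) \<cdot> (hneg C (farr \<Sigma>\<^sub>S (x ! 0)) \<cdot> ?P) =
        hneg C (farr \<Sigma> (x ! 0)) \<cdot> (\<theta> (?X 0) \<cdot> ?P)"
      proof -
        have "\<theta> (?X (Suc 0)) \<cdot> (hneg C (farr \<Sigma>\<^sub>S (x ! 0)) \<cdot> ?P) =
          hneg C (\<theta> (?X (Suc 0)) \<cdot> (farr \<Sigma>\<^sub>S (x ! 0) \<cdot> ?P))"
          using arrs0 by (simp add: hneg_cmp cmp_hneg)
        also have "\<dots> = hneg C (farr \<Sigma> (x ! 0) \<cdot> (\<theta> (?X 0) \<cdot> ?P))"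
          using natural[of "x ! 0" ?P] arrs0 by simp
        also have "\<dots> = hneg C (farr \<Sigma> (x ! 0)) \<cdot> (\<theta> (?X 0) \<cdot> ?P)"
          using arrs0 by (simp add: hneg_cmp)
        finally show ?thesis .
      qed
      have A: "\<theta> (?C 0) \<cdot> (farr \<Sigma>\<^sub>S (i 0) \<cdot> (hneg C (farr \<Sigma>\<^sub>S (x ! 0)) \<cdot> ?P)) =
        farr \<Sigma> (i 0) \<cdot> (hneg C (farr \<Sigma> (x ! 0)) \<cdot> (\<theta> (?X 0) \<cdot> ?P))"
        unfolding C0(1) by (subst natural) (use arrs0 neg in simp_all)
      have D: "\<theta> (?C 0) \<cdot> (farr \<Sigma>\<^sub>S (j 0) \<cdot> (farr \<Sigma>\<^sub>S (f 0) \<cdot> ?P)) =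
        farr \<Sigma> (j 0) \<cdot> (farr \<Sigma> (f 0) \<cdot> (\<theta> (?X 0) \<cdot> ?P))"
        unfolding C0(2) by (subst natural) (use arrs0 natural[of "f 0" ?P] in simp_all)
      \<comment> \<open>Naturality is used once here, not twice as in \<open>A\<close> and
        \<open>D\<close>: the \<theta> that remains at Y^0 is the one that \<open>\<Phi> y\<close>
        has on its last arrow.\<close>
      have E: "\<theta> (?C 0) \<cdot> (farr \<Sigma>\<^sub>S (j 0) \<cdot> (y ! Suc n \<cdot> ?Q)) =
        farr \<Sigma> (j 0) \<cdot> (\<theta> (?Y 0) \<cdot> (y ! Suc n \<cdot> ?Q))"
        unfolding C0(2) by (subst natural) (use arrs0 in simp_all)
      have "c ! Suc n = farr \<Sigma>\<^sub>S (i 0) \<cdot> hneg C (farr \<Sigma>\<^sub>S (x ! 0)) \<cdot> ?P \<boxplus>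
        farr \<Sigma>\<^sub>S (j 0) \<cdot> farr \<Sigma>\<^sub>S (f 0) \<cdot> ?P \<boxplus> farr \<Sigma>\<^sub>S (j 0) \<cdot> y ! Suc n \<cdot> ?Q"
        using eq[rule_format, of "Suc n"] ij x'(2)[of 0] x'(2)[of "Suc 0"] x'(3)[of 0]
        by (simp add: d hneg_full_subcategory)
      also have "\<dots> = farr \<Sigma>\<^sub>S (i 0) \<cdot> (hneg C (farr \<Sigma>\<^sub>S (x ! 0)) \<cdot> ?P) \<boxplus>
        farr \<Sigma>\<^sub>S (j 0) \<cdot> (farr \<Sigma>\<^sub>S (f 0) \<cdot> ?P) \<boxplus> farr \<Sigma>\<^sub>S (j 0) \<cdot> (y ! Suc n \<cdot> ?Q)"
        using arrs0 by (simp add: assoc)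
      finally have "\<theta> (?C 0) \<cdot> c ! Suc n = \<theta> (?C 0) \<cdot>
        (farr \<Sigma>\<^sub>S (i 0) \<cdot> (hneg C (farr \<Sigma>\<^sub>S (x ! 0)) \<cdot> ?P) \<boxplus>
        farr \<Sigma>\<^sub>S (j 0) \<cdot> (farr \<Sigma>\<^sub>S (f 0) \<cdot> ?P) \<boxplus> farr \<Sigma>\<^sub>S (j 0) \<cdot> (y ! Suc n \<cdot> ?Q))"
        by (simp only:)
      also have "\<dots> = farr \<Sigma> (i 0) \<cdot> (hneg C (farr \<Sigma> (x ! 0)) \<cdot> (\<theta> (?X 0) \<cdot> ?P)) \<boxplus>
        farr \<Sigma> (j 0) \<cdot> (farr \<Sigma> (f 0) \<cdot> (\<theta> (?X 0) \<cdot> ?P)) \<boxplus>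
        farr \<Sigma> (j 0) \<cdot> (\<theta> (?Y 0) \<cdot> (y ! Suc n \<cdot> ?Q))"
        using arrs0 c'[of 0] by (simp add: cmp_hplus A D E)
      finally have "\<theta> (?C 0) \<cdot> c ! Suc n =
        farr \<Sigma> (i 0) \<cdot> (hneg C (farr \<Sigma> (x ! 0)) \<cdot> (\<theta> (?X 0) \<cdot> ?P)) \<boxplus>
        farr \<Sigma> (j 0) \<cdot> (farr \<Sigma> (f 0) \<cdot> (\<theta> (?X 0) \<cdot> ?P)) \<boxplus>
        farr \<Sigma> (j 0) \<cdot> (\<theta> (?Y 0) \<cdot> (y ! Suc n \<cdot> ?Q))" .
      then show ?thesis
        using 3 arrs0 by (simp add: \<Phi>_nth x y c d i'_def j'_def p'_def assoc)
    qed
  qed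
  show ?thesis
    unfolding is_cone_def Let_def
    using sigma_sequence_\<Phi>[OF c] bip' eq'
    by (intro conjI exI[of _ i'] exI[of _ j'] exI[of _ p'] exI[of _ q])
      (simp_all add: i'_def j'_def)
qed

text \<open>(F4) in \<open>C\<close> covers every cone of the morphism it supplies. The same tuple
  serves in \<open>B\<close>, and it is enough that \<open>\<Phi>\<close> maps each of its cones
  there to a cone in \<open>C\<close>.\<close>

lemma strong_angulated_skeleton:
  assumes "weak_angulated_category n C \<Sigma> \<T>"
  shows "strong_angulated_category n B \<Sigma>\<^sub>S \<T>\<^sub>S"
proof -
  interpret weak_angulated_category n C \<Sigma> \<T> by (rule assms)
  interpret S: strong_pre_angulated_category n B \<Sigma>\<^sub>S \<T>\<^sub>S by (rule strong_pre_angulated_skeleton)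
  show ?thesis
  proof (intro strong_angulated_category.intro strong_angulated_category_axioms.intro
      weak_angulated_category.intro weak_angulated_category_axioms.intro
      S.weak_pre_angulated_category_axioms S.automorphism)
    fix x y f0 f1
    assume "x \<in> \<T>\<^sub>S" "y \<in> \<T>\<^sub>S"
      and f: "f0 \<in> Hom B (src B (x ! 0)) (src B (y ! 0))"
      "f1 \<in> Hom B (src B (x ! 1)) (src B (y ! 1))" "f1 \<cdot>\<^bsub>B\<^esub> x ! 0 = y ! 0 \<cdot>\<^bsub>B\<^esub> f0"
    then have x: "seq\<^sub>S x" "\<Phi> x \<in> \<T>" and y: "seq\<^sub>S y" "\<Phi> y \<in> \<T>" by (simp_all add: \<T>\<^sub>S_def)
    obtain f where f: "f 0 = f0" "f 1 = f1" "seq_morphism n C \<Sigma> (\<Phi> x) (\<Phi> y) f"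
      and cone: "\<forall>c. is_cone n C \<Sigma> (\<Phi> x) (\<Phi> y) f c \<longrightarrow> c \<in> \<T>"
      using F4[OF x(2) y(2) \<T>\<^sub>S_F3_square[OF x(1) y(1) f]] by blast
    have fB: "seq_morphism n B \<Sigma>\<^sub>S x y f" using f(3) unfolding seq_morphism_\<Phi>[OF x(1) y(1)] .
    have "c \<in> \<T>\<^sub>S" if "is_cone n B \<Sigma>\<^sub>S x y f c" for c
      using cone is_cone_\<Phi>[OF x(1) y(1) fB that] that by (simp add: \<T>\<^sub>S_def is_cone_def)
    then show "\<exists>f. f 0 = f0 \<and> f 1 = f1 \<and> seq_morphism n B \<Sigma>\<^sub>S x y f \<and>
        (\<forall>c. is_cone n B \<Sigma>\<^sub>S x y f c \<longrightarrow> c \<in> \<T>\<^sub>S)"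
      using f fB by blast
  qed
qed

end

section \<open>From an arbitrary skeleton to its set of objects\<close>

lemma (in category) category_skeleton_if_is_skeleton:
  assumes "is_skeleton D C"
  obtains S where "D = full_subcategory C S" "category_skeleton C S"
proof -
  obtain S where S: "S \<subseteq> ob C" "D = full_subcategory C S"
    and skel: "skeletal D" and ess: "essentially_surjective D C id_functor"
    using assms unfolding is_skeleton_def by blast
  have "category_skeleton C S"
  proof unfold_locales
    show "S \<subseteq> ob C" by (rule S)
    show "X = Y" if "X \<in> S" "Y \<in> S" "isomorphic C X Y" for X Y
      using skel that isomorphic_full_subcategory[of X S Y C] by (simp add: S skeletal_def)
    show "\<exists>Y \<in> S. isomorphic C X Y" if "X \<in> ob C" for X
      using ess that by (auto simp: S essentially_surjective_def id_functor_def intro: isomorphic_sym)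
  qed
  with S(2) show thesis by (rule that)
qed

lemma (in weak_pre_angulated_category) skeleton_of_angulated_if_is_skeleton:
  assumes "is_skeleton D C"
  obtains S \<Gamma> where "D = full_subcategory C S" "skeleton_of_angulated n C \<Sigma> \<T> S \<Gamma>"
proof -
  obtain S where S: "D = full_subcategory C S" "category_skeleton C S"
    by (rule category_skeleton_if_is_skeleton[OF assms])
  obtain \<Gamma> where \<Gamma>: "quasi_inverse_endofunctors C \<Sigma> \<Gamma>" by (rule obtain_quasi_inverse)
  have "skeleton_of_angulated n C \<Sigma> \<T> S \<Gamma>"
    by (intro skeleton_of_angulated.intro skeleton_autoequivalence.intro
      weak_pre_angulated_category_axioms S(2) \<Gamma>)
  with S(1) show thesis by (rule that)
qed

theorem corollary4p6:
  fixes n :: nat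
    and C Cskel :: "('o, 'm) add_cat_data"
    and \<Sigma> :: "('o, 'm, 'o, 'm) cat_functor"
    and \<T> :: "'m list set"
  assumes "n \<ge> 1"
    and "is_skeleton Cskel C"
  shows "(weak_pre_angulated_category n C \<Sigma> \<T> \<longrightarrow>
           (\<exists>\<Sigma>' \<T>'. strong_pre_angulated_category n Cskel \<Sigma>' \<T>')) \<and>
         (weak_angulated_category n C \<Sigma> \<T> \<longrightarrow>
           (\<exists>\<Sigma>' \<T>'. strong_angulated_category n Cskel \<Sigma>' \<T>'))"
proof (intro conjI impI)
  assume "weak_pre_angulated_category n C \<Sigma> \<T>"
  then interpret weak_pre_angulated_category n C \<Sigma> \<T> .
  obtain S \<Gamma> where S: "Cskel = full_subcategory C S" "skeleton_of_angulated n C \<Sigma> \<T> S \<Gamma>"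
    by (rule skeleton_of_angulated_if_is_skeleton[OF assms(2)])
  then show "\<exists>\<Sigma>' \<T>'. strong_pre_angulated_category n Cskel \<Sigma>' \<T>'"
    using skeleton_of_angulated.strong_pre_angulated_skeleton by blast
next
  assume weak: "weak_angulated_category n C \<Sigma> \<T>"
  then interpret weak_angulated_category n C \<Sigma> \<T> .
  obtain S \<Gamma> where S: "Cskel = full_subcategory C S" "skeleton_of_angulated n C \<Sigma> \<T> S \<Gamma>"
    by (rule skeleton_of_angulated_if_is_skeleton[OF assms(2)])
  then show "\<exists>\<Sigma>' \<T>'. strong_angulated_category n Cskel \<Sigma>' \<T>'"
    using skeleton_of_angulated.strong_angulated_skeleton[OF _ weak] by blast
qed

end
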